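(* Let $n\ge4$ be an integer, $a\in(0;1)$ and $t=a^2-a$. Then $$ A^2_{n,3}(a)=\frac{-t^{2n-7}}{((n-2)!)^2(2n-7)}\Bigl(4(2n-1)(2n-3)^2(2n-7)t^3+12(n-1)(n-2)(2n-3)(2n-7)t^2+3(n-2)^2(2n-3)(2n-7)t+(n-2)^2(n-3)^2\Bigr). $$
   Context: For integers $n\ge1$, $0\le k\le n-1$ and $a\in(0;1)$, $A_{n,k}(a):=\sup\{|f^{(k)}(a)| : f\in \mathring{W}_2^n[0;1],\ \int_0^1|f^{(n)}(x)|^2dx\le 1\}$ and $A^2_{n,k}(a)=(A_{n,k}(a))^2$. Here $\mathring{W}_2^n[0;1]$ is the space of functions $f$ on $[0;1]$ whose derivatives up to order $n-1$ are absolutely continuous, with $f^{(n)}\in L_2[0;1]$ and $f^{(j)}(0)=f^{(j)}(1)=0$ for $j=0,\dots,n-1$. *)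

theory Defs
  imports "HOL-Analysis.Analysis"
begin

text \<open>Absolute continuity on a compact interval. A finite system of non-overlapping intervals
  is given by the set of the pairs of their endpoints.\<close>

definition abs_cont_on :: "real \<Rightarrow> real \<Rightarrow> (real \<Rightarrow> real) \<Rightarrow> bool" where
  "abs_cont_on a b f \<longleftrightarrow>
     (\<forall>\<epsilon>>0. \<exists>\<delta>>0. \<forall>I :: (real \<times> real) set.
        finite I \<and> (\<forall>(u, v)\<in>I. a \<le> u \<and> u \<le> v \<and> v \<le> b) \<and>
        disjoint_family_on (\<lambda>(u, v). {u<..<v}) I \<and> (\<Sum>(u, v)\<in>I. v - u) < \<delta>
        \<longrightarrow> (\<Sum>(u, v)\<in>I. \<bar>f v - f u\<bar>) < \<epsilon>)"

text \<open>Derivatives are taken within \<open>{0..1}\<close> (one-sided at the endpoints), so that values of the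
  function outside the interval play no role. The value of \<open>D (Suc j) f\<close> at a point where
  \<open>D j f\<close> is not differentiable is arbitrary.\<close>

primrec D :: "nat \<Rightarrow> (real \<Rightarrow> real) \<Rightarrow> real \<Rightarrow> real" where
  "D 0 f = f"
| "D (Suc j) f = (\<lambda>x. vector_derivative (D j f) (at x within {0..1}))"

definition L2 :: "(real \<Rightarrow> real) set" where
  "L2 = {g. set_borel_measurable lebesgue {0..1} g \<and>
            set_integrable lebesgue {0..1} (\<lambda>x. \<bar>g x\<bar>\<^sup>2)}"

text \<open>The derivatives of order less than \<open>n\<close> exist everywhere on the interval, the one of order
  \<open>n\<close> almost everywhere. The latter is automatic, by absolute continuity of \<open>D (n - 1) f\<close>
  (Lebesgue); it is listed because it is what makes \<open>D n f\<close> meaningful.\<close>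

definition W0 :: "nat \<Rightarrow> (real \<Rightarrow> real) set" where
  "W0 n = {f.
     (\<forall>j. Suc j < n \<longrightarrow> (\<forall>x\<in>{0..1}. D j f differentiable at x within {0..1})) \<and>
     (\<forall>j<n. abs_cont_on 0 1 (D j f)) \<and>
     (AE x in lebesgue. x \<in> {0..1} \<longrightarrow> D (n - 1) f differentiable at x within {0..1}) \<and>
     D n f \<in> L2 \<and>
     (\<forall>j<n. D j f 0 = 0 \<and> D j f 1 = 0)}"

text \<open>The supremum is taken in the extended reals, where it exists without any boundedness
  assumption.\<close>

definition A :: "nat \<Rightarrow> nat \<Rightarrow> real \<Rightarrow> ereal" where
  "A n k a =
     (SUP f \<in> {f \<in> W0 n. (LINT x:{0..1}|lebesgue. \<bar>D n f x\<bar>\<^sup>2) \<le> 1}. ereal \<bar>D k f a\<bar>)"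

end

theory Submission
  imports Defs "HOL-Computational_Algebra.Polynomial"
begin

text \<open>Put \<open>h x = (a - x)\<^sup>l / l!\<close> for \<open>x \<le> a\<close> and \<open>h x = 0\<close> for \<open>x > a\<close>, where \<open>l = n - k - 1\<close>. By Taylor's formula
  the \<open>k\<close>-th derivative of \<open>f\<close> at \<open>a\<close> is the inner product of \<open>h\<close> and \<open>f\<^sup>(\<^sup>n\<^sup>)\<close>, and the functions \<open>f\<^sup>(\<^sup>n\<^sup>)\<close> are exactly the
  elements of \<open>L\<^sub>2\<close> orthogonal to all polynomials of degree less than \<open>n\<close>. So \<open>(A n k a)\<^sup>2\<close> is the squared
  distance of \<open>h\<close> from these polynomials. Subtracting the squares of the Legendre coefficients of \<open>h\<close> from
  its squared norm, one finds \<open>- t\<^sup>2\<^sup>l\<^sup>+\<^sup>1 / ((2l + 1) l!\<^sup>2)\<close> after the first \<open>l + 1\<close> of them, because the derivative in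
  \<open>a\<close> telescopes. By the formula of Rodrigues, the other \<open>k\<close> coefficients are derivatives of
  order less than \<open>k\<close> of powers of \<open>t = a\<^sup>2 - a\<close>.\<close>

hide_const (open) Polynomial.content

section \<open>Integration of absolutely continuous functions\<close>

lemma abs_cont_onD:
  assumes "abs_cont_on a b f" "e > 0"
  obtains d where "d > 0" "\<And>I. finite I \<Longrightarrow> (\<And>u v. (u, v) \<in> I \<Longrightarrow> a \<le> u \<and> u \<le> v \<and> v \<le> b) \<Longrightarrow>
    disjoint_family_on (\<lambda>(u, v). {u<..<v}) I \<Longrightarrow> (\<Sum>(u, v)\<in>I. v - u) < d \<Longrightarrow>
    (\<Sum>(u, v)\<in>I. \<bar>f v - f u\<bar>) < e"
proof -
  obtain d where "d > 0" and d: "\<forall>I :: (real \<times> real) set.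
        finite I \<and> (\<forall>(u, v)\<in>I. a \<le> u \<and> u \<le> v \<and> v \<le> b) \<and>
        disjoint_family_on (\<lambda>(u, v). {u<..<v}) I \<and> (\<Sum>(u, v)\<in>I. v - u) < d
        \<longrightarrow> (\<Sum>(u, v)\<in>I. \<bar>f v - f u\<bar>) < e"
    using assms unfolding abs_cont_on_def by blast
  show ?thesis
  proof (rule that[OF \<open>d > 0\<close>])
    fix I :: "(real \<times> real) set"
    assume "finite I" "disjoint_family_on (\<lambda>(u, v). {u<..<v}) I" "(\<Sum>(u, v)\<in>I. v - u) < d"
      and I: "\<And>u v. (u, v) \<in> I \<Longrightarrow> a \<le> u \<and> u \<le> v \<and> v \<le> b"
    moreover have "\<forall>(u, v)\<in>I. a \<le> u \<and> u \<le> v \<and> v \<le> b" using I by blast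
    ultimately show "(\<Sum>(u, v)\<in>I. \<bar>f v - f u\<bar>) < e" using d by blast
  qed
qed

text \<open>The definition indexes intervals by their endpoints, a division also by tags. Two pairs
  with the same endpoints have equal but disjoint interiors, hence are degenerate, so passing to the
  image under \<open>h\<close> loses only zero terms.\<close>

lemma abs_cont_on_tagged:
  assumes "abs_cont_on a b f" "e > 0"
  obtains d where "d > 0" "\<And>p. p tagged_partial_division_of {a..b} \<Longrightarrow>
    (\<Sum>(x, K)\<in>p. content K) < d \<Longrightarrow> (\<Sum>(x, K)\<in>p. \<bar>f (Sup K) - f (Inf K)\<bar>) < e"
proof -
  obtain d where "d > 0" and d: "\<And>I. finite I \<Longrightarrow> (\<And>u v. (u, v) \<in> I \<Longrightarrow> a \<le> u \<and> u \<le> v \<and> v \<le> b) \<Longrightarrow>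
    disjoint_family_on (\<lambda>(u, v). {u<..<v}) I \<Longrightarrow> (\<Sum>(u, v)\<in>I. v - u) < d \<Longrightarrow>
    (\<Sum>(u, v)\<in>I. \<bar>f v - f u\<bar>) < e"
    using abs_cont_onD[OF assms] by blast
  show ?thesis
  proof (rule that[OF \<open>d > 0\<close>])
    fix p :: "(real \<times> real set) set"
    assume p: "p tagged_partial_division_of {a..b}" and small: "(\<Sum>(x, K)\<in>p. content K) < d"
    note pD = tagged_partial_division_ofD[OF p]
    define h where "h = (\<lambda>(x::real, K::real set). (Inf K, Sup K))"
    have K: "\<exists>u v. K = {u..v} \<and> u \<le> v \<and> a \<le> u \<and> v \<le> b \<and> Inf K = u \<and> Sup K = v" if xK: "(x, K) \<in> p" for x K
    proof -
      obtain u v where uv: "K = {u..v}" using pD(4)[OF xK] by auto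
      moreover have "u \<le> v" using pD(2)[OF xK] uv by auto
      moreover have "a \<le> u" "v \<le> b" using pD(3)[OF xK] uv \<open>u \<le> v\<close> by auto
      ultimately show ?thesis by auto
    qed
    have inter: "{Inf K<..<Sup K} = interior K" if xK: "(x, K) \<in> p" for x K
    proof -
      obtain u v where "K = {u..v}" "Inf K = u" "Sup K = v" using K[OF xK] by blast
      then show ?thesis by (simp add: interior_atLeastAtMost_real)
    qed
    have nontriv: "Inf K = Sup K"
      if "(x, K) \<in> p" "(x', K') \<in> p" "(x, K) \<noteq> (x', K')" "h (x, K) = h (x', K')" for x K x' K'
    proof -
      have "interior K \<inter> interior K' = {}" using pD(5)[OF that(1-3)] .
      moreover have "interior K = interior K'"
        using inter[OF that(1)] inter[OF that(2)] that(4) by (simp add: h_def)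
      ultimately have "{Inf K<..<Sup K} = {}" using inter[OF that(1)] by simp
      moreover have "Inf K \<le> Sup K" using K[OF that(1)] by metis
      ultimately show ?thesis by (simp add: greaterThanLessThan_empty_iff)
    qed
    have reindex: "(\<Sum>(u, v)\<in>h ` p. g u v) = (\<Sum>(x, K)\<in>p. g (Inf K) (Sup K))"
      if g0: "\<And>u. g u u = 0" for g :: "real \<Rightarrow> real \<Rightarrow> real"
    proof -
      have "(\<Sum>(u, v)\<in>h ` p. g u v) = sum ((\<lambda>(u, v). g u v) \<circ> h) p"
      proof (rule sum.reindex_nontrivial[OF pD(1)])
        fix y z assume yz: "y \<in> p" "z \<in> p" "y \<noteq> z" "h y = h z"
        obtain x K where y: "y = (x, K)" by fastforce
        obtain x' K' where z: "z = (x', K')" by fastforce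
        have "Inf K = Sup K" using nontriv yz unfolding y z by blast
        then show "(case h y of (u, v) \<Rightarrow> g u v) = 0" by (simp add: y h_def g0)
      qed
      then show ?thesis by (simp add: h_def case_prod_unfold o_def)
    qed
    have "(\<Sum>(u, v)\<in>h ` p. \<bar>f v - f u\<bar>) < e"
    proof (rule d)
      show "finite (h ` p)" using pD(1) by simp
      show "a \<le> u \<and> u \<le> v \<and> v \<le> b" if "(u, v) \<in> h ` p" for u v
      proof -
        obtain x K where xK: "(x, K) \<in> p" and uv: "u = Inf K" "v = Sup K"
          using \<open>(u, v) \<in> h ` p\<close> by (auto simp: h_def)
        show ?thesis using K[OF xK] unfolding uv by metis
      qed
      show "disjoint_family_on (\<lambda>(u, v). {u<..<v}) (h ` p)"
        unfolding disjoint_family_on_def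
      proof (intro ballI impI)
        fix y z assume yz: "y \<in> h ` p" "z \<in> h ` p" "y \<noteq> z"
        obtain x K where y: "(x, K) \<in> p" "y = (Inf K, Sup K)" using yz(1) by (auto simp: h_def)
        obtain x' K' where z: "(x', K') \<in> p" "z = (Inf K', Sup K')" using yz(2) by (auto simp: h_def)
        have "interior K \<inter> interior K' = {}" using pD(5)[OF y(1) z(1)] yz(3) y(2) z(2) by blast
        then show "(case y of (u, v) \<Rightarrow> {u<..<v}) \<inter> (case z of (u, v) \<Rightarrow> {u<..<v}) = {}"
          using inter[OF y(1)] inter[OF z(1)] y z by simp
      qed
      have "(\<Sum>(u, v)\<in>h ` p. v - u) = (\<Sum>(x, K)\<in>p. Sup K - Inf K)" by (rule reindex) simp
      also have "\<dots> = (\<Sum>(x, K)\<in>p. content K)"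
      proof (rule sum.cong)
        fix y assume "y \<in> p"
        then obtain x K where y: "y = (x, K)" and xK: "(x, K) \<in> p" by (cases y) auto
        obtain u v where "K = {u..v}" "u \<le> v" using K[OF xK] by blast
        then show "(case y of (x, K) \<Rightarrow> Sup K - Inf K) = (case y of (x, K) \<Rightarrow> content K)" by (simp add: y)
      qed simp
      finally show "(\<Sum>(u, v)\<in>h ` p. v - u) < d" using small by simp
    qed
    also have "(\<Sum>(u, v)\<in>h ` p. \<bar>f v - f u\<bar>) = (\<Sum>(x, K)\<in>p. \<bar>f (Sup K) - f (Inf K)\<bar>)"
      by (rule reindex) simp
    finally show "(\<Sum>(x, K)\<in>p. \<bar>f (Sup K) - f (Inf K)\<bar>) < e" .
  qed
qed

text \<open>Intervals of a partial division do not overlap, so their contents add up to the measure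
  of their union.\<close>

lemma sum_content_le_measure:
  fixes p :: "('a::euclidean_space \<times> 'a set) set"
  assumes p: "p tagged_partial_division_of S" and sub: "\<And>x K. (x, K) \<in> p \<Longrightarrow> K \<subseteq> U"
    and U: "U \<in> lmeasurable"
  shows "(\<Sum>(x, K)\<in>p. content K) \<le> measure lebesgue U"
proof -
  note tag = tagged_partial_division_of_Union_self[OF p]
  note div = division_of_tagged_division[OF tag]
  have "(\<Sum>(x, K)\<in>p. content K) = sum content (snd ` p)"
    by (rule sum.over_tagged_division_lemma[OF tag]) (simp add: content_eq_0_interior)
  also have "\<dots> = (\<Sum>K\<in>snd ` p. measure lebesgue K)"
    by (rule sum.cong) (use div in \<open>auto simp: division_of_def\<close>)
  also have "\<dots> = measure lebesgue (\<Union> (snd ` p))"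
    by (rule content_division[OF div])
  also have "\<dots> \<le> measure lebesgue U"
  proof (rule measure_mono_fmeasurable)
    show "\<Union> (snd ` p) \<subseteq> U" using sub by fastforce
    show "\<Union> (snd ` p) \<in> sets lebesgue" using lmeasurable_division[OF div] by (rule fmeasurableD)
  qed (rule U)
  finally show ?thesis .
qed

text \<open>Outer regularity yields an open superset exceeding \<open>N\<close> by little, and the
  null set \<open>N\<close> itself adds no measure.\<close>

lemma negligible_outer_open:
  fixes N :: "'a::euclidean_space set"
  assumes "negligible N" "e > 0"
  obtains U where "open U" "N \<subseteq> U" "U \<in> lmeasurable" "measure lebesgue U < e"
proof -
  have N: "N \<in> null_sets lebesgue" using assms(1) negligible_iff_null_sets by blast
  obtain U where U: "open U" "N \<subseteq> U" "U - N \<in> lmeasurable" "emeasure lebesgue (U - N) < ennreal e"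
    using sets_lebesgue_outer_open[of N e] N assms(2) by auto
  have "U = (U - N) \<union> N" using U(2) by blast
  moreover have "measure lebesgue ((U - N) \<union> N) = measure lebesgue (U - N)"
    by (rule measure_Un_null_set) (use U(3) N in \<open>auto simp: fmeasurable_def\<close>)
  moreover have "measure lebesgue (U - N) < e"
    using U(4) assms(2) U(3) by (simp add: emeasure_eq_measure2 ennreal_less_iff)
  moreover have "N \<in> lmeasurable" using assms(1) by (simp add: negligible_imp_measurable)
  ultimately show ?thesis using that[of U] U by (metis fmeasurable.Un)
qed

text \<open>Near a point of differentiability the usual straddle estimate works; intervals tagged in the
  exceptional null set are forced into an open set of small measure, where absolute continuity
  bounds the increments of \<open>f\<close>.\<close>

theorem has_integral_derivative_abs_cont:
  assumes "a \<le> b" and ac: "abs_cont_on a b f" and N: "negligible N"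
    and deriv: "\<And>x. x \<in> {a..b} - N \<Longrightarrow> (f has_vector_derivative f' x) (at x within {a..b})"
  shows "(f' has_integral (f b - f a)) {a..b}"
proof -
  \<comment> \<open>With the value 0 on \<open>N\<close>, an interval tagged in \<open>N\<close>
    contributes nothing but the increment of \<open>f\<close>.\<close>
  define g where "g x = (if x \<in> N then 0 else f' x)" for x
  have "(g has_integral (f b - f a)) (cbox a b)"
    unfolding has_integral
  proof (intro allI impI)
    fix \<epsilon> :: real assume "\<epsilon> > 0"
    \<comment> \<open>The summand 1 keeps the denominator positive for \<open>a = b\<close> and
      makes the next bound strict.\<close>
    define e where "e = \<epsilon> / 2 / (b - a + 1)"
    have "e > 0" using \<open>\<epsilon> > 0\<close> \<open>a \<le> b\<close> by (simp add: e_def)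
    have e: "e * (b - a) < \<epsilon> / 2"
      using \<open>\<epsilon> > 0\<close> \<open>a \<le> b\<close> by (simp add: e_def field_simps)
    obtain \<delta> where "\<delta> > 0" and \<delta>: "\<And>p. p tagged_partial_division_of {a..b} \<Longrightarrow>
        (\<Sum>(x, K)\<in>p. content K) < \<delta> \<Longrightarrow> (\<Sum>(x, K)\<in>p. \<bar>f (Sup K) - f (Inf K)\<bar>) < \<epsilon> / 2"
      using abs_cont_on_tagged[OF ac, of "\<epsilon> / 2"] \<open>\<epsilon> > 0\<close> by auto
    obtain U where U: "open U" "N \<subseteq> U" "U \<in> lmeasurable" "measure lebesgue U < \<delta>"
      using negligible_outer_open[OF N \<open>\<delta> > 0\<close>] .
    \<comment> \<open>Radii of the gauge: a ball inside \<open>U\<close> at points of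
      \<open>N\<close>, the differentiability estimate at the other points of the interval.\<close>
    have "\<forall>x. \<exists>d>0. (x \<in> N \<longrightarrow> ball x d \<subseteq> U) \<and> (x \<in> {a..b} - N \<longrightarrow>
         (\<forall>y\<in>{a..b}. norm (y-x) < d \<longrightarrow> norm (f y - f x - (y-x) *\<^sub>R f' x) \<le> e * norm (y-x)))"
    proof
      fix x
      show "\<exists>d>0. (x \<in> N \<longrightarrow> ball x d \<subseteq> U) \<and> (x \<in> {a..b} - N \<longrightarrow>
         (\<forall>y\<in>{a..b}. norm (y-x) < d \<longrightarrow> norm (f y - f x - (y-x) *\<^sub>R f' x) \<le> e * norm (y-x)))"
      proof (cases "x \<in> N")
        case True
        then obtain d where "d > 0" "ball x d \<subseteq> U" using U(1,2) openE by blast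
        then show ?thesis using True by auto
      next
        case False
        show ?thesis
        proof (cases "x \<in> {a..b}")
          case True
          then show ?thesis
            using deriv[of x] False \<open>e > 0\<close>
            unfolding has_vector_derivative_def has_derivative_within_alt by blast
        qed (use False in \<open>auto intro: exI[of _ 1]\<close>)
      qed
    qed
    then obtain d where d0: "\<And>x. d x > 0" and dN: "\<And>x. x \<in> N \<Longrightarrow> ball x (d x) \<subseteq> U"
      and d: "\<And>x y. x \<in> {a..b} - N \<Longrightarrow> y \<in> {a..b} \<Longrightarrow> norm (y-x) < d x \<Longrightarrow>
          norm (f y - f x - (y-x) *\<^sub>R f' x) \<le> e * norm (y-x)"
      by metis
    show "\<exists>\<gamma>. gauge \<gamma> \<and> (\<forall>p. p tagged_division_of cbox a b \<and> \<gamma> fine p \<longrightarrow>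
        norm ((\<Sum>(x, K)\<in>p. content K *\<^sub>R g x) - (f b - f a)) < \<epsilon>)"
    proof (rule exI, safe)
      show "gauge (\<lambda>x. ball x (d x))"
        using d0 gauge_ball_dependent by blast
    next
      fix p
      assume ptag: "p tagged_division_of cbox a b" and finep: "(\<lambda>x. ball x (d x)) fine p"
      note pD = tagged_division_ofD[OF ptag]
      have ptag': "p tagged_partial_division_of {a..b}" using ptag by (simp add: tagged_division_of_def)
      have K: "\<exists>u v. K = {u..v} \<and> u \<le> v \<and> u \<in> K \<and> v \<in> K \<and> Inf K = u \<and> Sup K = v"
        if xK: "(x, K) \<in> p" for x K
      proof -
        obtain u v where uv: "K = {u..v}" using pD(4)[OF xK] by auto
        moreover have "u \<le> v" using pD(2)[OF xK] uv by auto
        ultimately show ?thesis by auto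
      qed
      define F where "F = (\<lambda>(x, K). content K *\<^sub>R g x - (f (Sup K) - f (Inf K)))"
      \<comment> \<open>Absolute continuity bounds the sum over \<open>q\<close>, the straddle
        estimate the sum over the rest.\<close>
      define q where "q = {xK \<in> p. fst xK \<in> N}"
      have fin: "finite p" "finite q" using pD(1) by (auto simp: q_def)
      have ba: "b - a = (\<Sum>(x,K)\<in>p. Sup K - Inf K)" "f b - f a = (\<Sum>(x,K)\<in>p. f(Sup K) - f(Inf K))"
        using additive_tagged_division_1[where f= "\<lambda>x. x"] additive_tagged_division_1[where f= f]
            \<open>a \<le> b\<close> ptag by auto
      have "(\<Sum>(x, K)\<in>p. content K *\<^sub>R g x) - (f b - f a) = sum F p"
        unfolding ba F_def by (simp add: split_def sum_subtractf)
      also have "\<dots> = sum F (p - q) + sum F q"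
        using sum.subset_diff[of q p F] fin by (auto simp: q_def)
      finally have "norm ((\<Sum>(x, K)\<in>p. content K *\<^sub>R g x) - (f b - f a)) \<le> norm (sum F (p - q)) + norm (sum F q)"
        by (simp add: norm_triangle_ineq)
      moreover have "norm (sum F q) < \<epsilon> / 2"
      proof -
        have q': "q tagged_partial_division_of {a..b}"
          by (rule tagged_partial_division_subset[OF ptag']) (auto simp: q_def)
        have "K \<subseteq> U" if "(x, K) \<in> q" for x K
          using that dN finep unfolding q_def fine_def by fastforce
        then have "(\<Sum>(x, K)\<in>q. content K) < \<delta>"
          using sum_content_le_measure[OF q' _ U(3)] U(4) by force
        then have "(\<Sum>(x, K)\<in>q. \<bar>f (Sup K) - f (Inf K)\<bar>) < \<epsilon> / 2"
          by (rule \<delta>[OF q'])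
        moreover have "norm (sum F q) \<le> (\<Sum>(x, K)\<in>q. \<bar>f (Sup K) - f (Inf K)\<bar>)"
          by (rule sum_norm_le) (auto simp: q_def F_def g_def)
        ultimately show ?thesis by linarith
      qed
      moreover have "norm (sum F (p - q)) \<le> e * (b - a)"
      proof -
        have "norm (sum F (p - q)) \<le> (\<Sum>xK\<in>p - q. e * (case xK of (x, K) \<Rightarrow> Sup K - Inf K))"
        proof (rule sum_norm_le)
          fix y assume "y \<in> p - q"
          then obtain x K where y: "y = (x, K)" and xK: "(x, K) \<in> p" "(x, K) \<notin> q"
            by (cases y) auto
          then have xN: "x \<notin> N" by (simp add: q_def)
          have "x \<in> K" and kab: "K \<subseteq> {a..b}" using pD(2,3)[OF xK(1)] by auto
          obtain u v where k: "K = {u..v}" "u \<le> v" "u \<in> K" "v \<in> K" "Inf K = u" "Sup K = v"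
            using K[OF xK(1)] by blast
          have ball: "norm (y - x) < d x" if "y \<in> K" for y
            using fineD[OF finep xK(1)] that by (auto simp: dist_real_def abs_minus_commute)
          have x: "x \<in> {a..b} - N" using xN kab \<open>x \<in> K\<close> by auto
          have "norm ((v - u) *\<^sub>R f' x - (f v - f u))
              = norm (f u - f x - (u - x) *\<^sub>R f' x - (f v - f x - (v - x) *\<^sub>R f' x))"
            by (auto simp: algebra_simps)
          also have "\<dots> \<le> norm (f u - f x - (u - x) *\<^sub>R f' x) + norm (f v - f x - (v - x) *\<^sub>R f' x)"
            by (rule norm_triangle_ineq4)
          also have "\<dots> \<le> e * norm (u - x) + e * norm (v - x)"
            using k kab by (intro add_mono d x ball) auto
          also have "\<dots> = e * (v - u)"
            using \<open>x \<in> K\<close> k(1) by (auto simp: algebra_simps)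
          finally have *: "norm ((v - u) *\<^sub>R f' x - (f v - f u)) \<le> e * (v - u)" .
          have "content K = v - u" using k by simp
          with * show "norm (F y) \<le> e * (case y of (x, K) \<Rightarrow> Sup K - Inf K)"
            using xN k(5,6) by (simp add: y F_def g_def)
        qed
        also have "\<dots> \<le> (\<Sum>xK\<in>p. e * (case xK of (x, K) \<Rightarrow> Sup K - Inf K))"
        proof (rule sum_mono2)
          show "0 \<le> e * (case xK of (x, K) \<Rightarrow> Sup K - Inf K)" if mem: "xK \<in> p - (p - q)" for xK
          proof -
            obtain x K where y: "xK = (x, K)" and xK: "(x, K) \<in> p" using mem by (cases xK) auto
            have "Inf K \<le> Sup K" using K[OF xK] by metis
            then show ?thesis using \<open>e > 0\<close> by (simp add: y)
          qed
        qed (use fin in auto)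
        also have "\<dots> = e * (b - a)"
          unfolding ba(1) by (simp add: sum_distrib_left)
        finally show ?thesis .
      qed
      ultimately show "norm ((\<Sum>(x, K)\<in>p. content K *\<^sub>R g x) - (f b - f a)) < \<epsilon>"
        using e by linarith
    qed
  qed
  then show ?thesis
    using has_integral_spike[OF N, of "{a..b}" f' g] by (auto simp: g_def)
qed

section \<open>Closure properties of absolute continuity\<close>

lemma abs_cont_onI:
  assumes "\<And>e. e > 0 \<Longrightarrow> \<exists>d>0. \<forall>I. finite I \<longrightarrow> (\<forall>(u, v)\<in>I. a \<le> u \<and> u \<le> v \<and> v \<le> b) \<longrightarrow>
        disjoint_family_on (\<lambda>(u, v). {u<..<v}) I \<longrightarrow> (\<Sum>(u, v)\<in>I. v - u) < d \<longrightarrow>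
        (\<Sum>(u, v)\<in>I. \<bar>f v - f u\<bar>) < e"
  shows "abs_cont_on a b f"
  using assms unfolding abs_cont_on_def by (simp add: imp_conjL)

text \<open>The criterion behind most closure properties below: a bound on the total length that
  serves both \<open>f\<close> and \<open>g\<close> for a fraction of \<epsilon> serves
  \<open>h\<close> for \<epsilon>.\<close>

lemma abs_cont_on_dominated:
  assumes f: "abs_cont_on a b f" and g: "abs_cont_on a b g"
    and dom: "\<And>u v. a \<le> u \<Longrightarrow> u \<le> v \<Longrightarrow> v \<le> b \<Longrightarrow> \<bar>h v - h u\<bar> \<le> B * (\<bar>f v - f u\<bar> + \<bar>g v - g u\<bar>)"
  shows "abs_cont_on a b h"
proof (rule abs_cont_onI)
  fix e :: real assume "e > 0"
  \<comment> \<open>\<open>B\<close> may be zero or negative; \<open>C\<close> is a positive bound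
    that can be divided by.\<close>
  define C where "C = \<bar>B\<bar> + 1"
  have "C > 0" by (simp add: C_def)
  define e' where "e' = e / (2 * C)"
  have "e' > 0" using \<open>e > 0\<close> \<open>C > 0\<close> by (simp add: e'_def)
  obtain d1 where d1: "d1 > 0" "\<And>I. finite I \<Longrightarrow> (\<And>u v. (u, v) \<in> I \<Longrightarrow> a \<le> u \<and> u \<le> v \<and> v \<le> b) \<Longrightarrow>
    disjoint_family_on (\<lambda>(u, v). {u<..<v}) I \<Longrightarrow> (\<Sum>(u, v)\<in>I. v - u) < d1 \<Longrightarrow>
    (\<Sum>(u, v)\<in>I. \<bar>f v - f u\<bar>) < e'"
    using abs_cont_onD[OF f \<open>e' > 0\<close>] by blast
  obtain d2 where d2: "d2 > 0" "\<And>I. finite I \<Longrightarrow> (\<And>u v. (u, v) \<in> I \<Longrightarrow> a \<le> u \<and> u \<le> v \<and> v \<le> b) \<Longrightarrow>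
    disjoint_family_on (\<lambda>(u, v). {u<..<v}) I \<Longrightarrow> (\<Sum>(u, v)\<in>I. v - u) < d2 \<Longrightarrow>
    (\<Sum>(u, v)\<in>I. \<bar>g v - g u\<bar>) < e'"
    using abs_cont_onD[OF g \<open>e' > 0\<close>] by blast
  show "\<exists>d>0. \<forall>I. finite I \<longrightarrow> (\<forall>(u, v)\<in>I. a \<le> u \<and> u \<le> v \<and> v \<le> b) \<longrightarrow>
        disjoint_family_on (\<lambda>(u, v). {u<..<v}) I \<longrightarrow> (\<Sum>(u, v)\<in>I. v - u) < d \<longrightarrow>
        (\<Sum>(u, v)\<in>I. \<bar>h v - h u\<bar>) < e"
  proof (intro exI[of _ "min d1 d2"] conjI allI impI)
    fix I :: "(real \<times> real) set"
    assume fin: "finite I" and uv: "\<forall>(u, v)\<in>I. a \<le> u \<and> u \<le> v \<and> v \<le> b"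
      and dis: "disjoint_family_on (\<lambda>(u, v). {u<..<v}) I" and small: "(\<Sum>(u, v)\<in>I. v - u) < min d1 d2"
    have uv': "a \<le> u \<and> u \<le> v \<and> v \<le> b" if "(u, v) \<in> I" for u v using uv that by blast
    have "(\<Sum>(u, v)\<in>I. \<bar>h v - h u\<bar>) \<le> (\<Sum>(u, v)\<in>I. C * (\<bar>f v - f u\<bar> + \<bar>g v - g u\<bar>))"
    proof (rule sum_mono)
      fix x assume "x \<in> I"
      then obtain u v where x: "x = (u, v)" and mem: "(u, v) \<in> I" by (cases x) auto
      have "\<bar>h v - h u\<bar> \<le> B * (\<bar>f v - f u\<bar> + \<bar>g v - g u\<bar>)" using uv'[OF mem] by (intro dom) auto
      also have "\<dots> \<le> C * (\<bar>f v - f u\<bar> + \<bar>g v - g u\<bar>)" by (intro mult_right_mono) (auto simp: C_def)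
      finally show "(case x of (u, v) \<Rightarrow> \<bar>h v - h u\<bar>) \<le> (case x of (u, v) \<Rightarrow> C * (\<bar>f v - f u\<bar> + \<bar>g v - g u\<bar>))"
        by (simp add: x)
    qed
    also have "\<dots> = C * ((\<Sum>(u, v)\<in>I. \<bar>f v - f u\<bar>) + (\<Sum>(u, v)\<in>I. \<bar>g v - g u\<bar>))"
      by (simp add: sum_distrib_left sum.distrib[symmetric] case_prod_unfold)
    also have "\<dots> < C * (e' + e')"
      using d1(2)[OF fin uv' dis] d2(2)[OF fin uv' dis] small \<open>C > 0\<close>
      by (intro mult_strict_left_mono add_strict_mono) auto
    also have "\<dots> = e" using \<open>C > 0\<close> by (simp add: e'_def field_simps)
    finally show "(\<Sum>(u, v)\<in>I. \<bar>h v - h u\<bar>) < e" .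
  qed (use d1 d2 in auto)
qed

lemma abs_cont_on_ident: "abs_cont_on a b (\<lambda>x. x)"
proof (rule abs_cont_onI)
  fix e :: real assume "e > 0"
  have *: "(\<Sum>(u, v)\<in>I. \<bar>v - u\<bar>) = (\<Sum>(u, v)\<in>I. v - u)"
    if "\<forall>(u, v)\<in>I. a \<le> u \<and> u \<le> v \<and> v \<le> b" for I
    by (rule sum.cong) (use that in auto)
  show "\<exists>d>0. \<forall>I. finite I \<longrightarrow> (\<forall>(u, v)\<in>I. a \<le> u \<and> u \<le> v \<and> v \<le> b) \<longrightarrow>
        disjoint_family_on (\<lambda>(u, v). {u<..<v}) I \<longrightarrow> (\<Sum>(u, v)\<in>I. v - u) < d \<longrightarrow>
        (\<Sum>(u, v)\<in>I. \<bar>v - u\<bar>) < e"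
    by (intro exI[of _ e] conjI allI impI) (simp_all add: * \<open>e > 0\<close>)
qed

lemma abs_cont_on_lipschitz:
  assumes "\<And>u v. a \<le> u \<Longrightarrow> u \<le> v \<Longrightarrow> v \<le> b \<Longrightarrow> \<bar>h v - h u\<bar> \<le> B * (v - u)"
  shows "abs_cont_on a b h"
proof (rule abs_cont_on_dominated[OF abs_cont_on_ident abs_cont_on_ident])
  \<comment> \<open>The identity plays the part of both dominating functions, hence the
    half.\<close>
  show "\<bar>h v - h u\<bar> \<le> (B / 2) * (\<bar>v - u\<bar> + \<bar>v - u\<bar>)" if "a \<le> u" "u \<le> v" "v \<le> b" for u v
    using assms[OF that] that by (simp add: field_simps)
qed

lemma abs_cont_on_const: "abs_cont_on a b (\<lambda>x. c)"
  by (rule abs_cont_on_lipschitz[of _ _ _ 0]) simp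

lemma abs_cont_on_cong:
  assumes "abs_cont_on a b f" "\<And>x. x \<in> {a..b} \<Longrightarrow> g x = f x"
  shows "abs_cont_on a b g"
  by (rule abs_cont_on_dominated[OF assms(1) assms(1), of _ 1]) (simp add: assms(2))

lemma abs_cont_on_add:
  assumes "abs_cont_on a b f" "abs_cont_on a b g"
  shows "abs_cont_on a b (\<lambda>x. f x + g x)"
  by (rule abs_cont_on_dominated[OF assms, of _ 1]) simp

lemma abs_cont_on_subinterval:
  assumes f: "abs_cont_on a b f" and "a \<le> c" "d \<le> b"
  shows "abs_cont_on c d f"
proof (rule abs_cont_onI)
  fix e :: real assume "e > 0"
  obtain d1 where d1: "d1 > 0" "\<And>I. finite I \<Longrightarrow> (\<And>u v. (u, v) \<in> I \<Longrightarrow> a \<le> u \<and> u \<le> v \<and> v \<le> b) \<Longrightarrow>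
    disjoint_family_on (\<lambda>(u, v). {u<..<v}) I \<Longrightarrow> (\<Sum>(u, v)\<in>I. v - u) < d1 \<Longrightarrow>
    (\<Sum>(u, v)\<in>I. \<bar>f v - f u\<bar>) < e"
    using abs_cont_onD[OF f \<open>e > 0\<close>] by blast
  show "\<exists>\<delta>>0. \<forall>I. finite I \<longrightarrow> (\<forall>(u, v)\<in>I. c \<le> u \<and> u \<le> v \<and> v \<le> d) \<longrightarrow>
        disjoint_family_on (\<lambda>(u, v). {u<..<v}) I \<longrightarrow> (\<Sum>(u, v)\<in>I. v - u) < \<delta> \<longrightarrow>
        (\<Sum>(u, v)\<in>I. \<bar>f v - f u\<bar>) < e"
  proof (intro exI[of _ d1] conjI allI impI d1)
    fix I :: "(real \<times> real) set" and u v
    assume "\<forall>(u, v)\<in>I. c \<le> u \<and> u \<le> v \<and> v \<le> d" "(u, v) \<in> I"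
    then have "c \<le> u \<and> u \<le> v \<and> v \<le> d" by blast
    then show "a \<le> u" "u \<le> v" "v \<le> b" using assms by auto
  qed
qed

lemma abs_cont_on_imp_continuous_on:
  assumes f: "abs_cont_on a b f"
  shows "continuous_on {a..b} f"
  unfolding continuous_on_iff
proof (intro ballI allI impI)
  fix x e :: real assume x: "x \<in> {a..b}" and "e > 0"
  obtain d where d: "d > 0" "\<And>I. finite I \<Longrightarrow> (\<And>u v. (u, v) \<in> I \<Longrightarrow> a \<le> u \<and> u \<le> v \<and> v \<le> b) \<Longrightarrow>
    disjoint_family_on (\<lambda>(u, v). {u<..<v}) I \<Longrightarrow> (\<Sum>(u, v)\<in>I. v - u) < d \<Longrightarrow>
    (\<Sum>(u, v)\<in>I. \<bar>f v - f u\<bar>) < e"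
    using abs_cont_onD[OF f \<open>e > 0\<close>] by blast
  have *: "\<bar>f v - f u\<bar> < e" if "a \<le> u" "u \<le> v" "v \<le> b" "v - u < d" for u v
    using d(2)[of "{(u, v)}"] that by (simp add: disjoint_family_on_def)
  show "\<exists>d>0. \<forall>x'\<in>{a..b}. dist x' x < d \<longrightarrow> dist (f x') (f x) < e"
  proof (intro exI[of _ d] conjI ballI impI)
    fix y assume "y \<in> {a..b}" "dist y x < d"
    then show "dist (f y) (f x) < e"
      using *[of x y] *[of y x] x by (cases "x \<le> y") (auto simp: dist_real_def abs_minus_commute)
  qed (rule d(1))
qed

text \<open>Continuity on a compact interval bounds both factors; the increment of the product is
  split by inserting the mixed term \<open>f u * g v\<close>.\<close>

lemma abs_cont_on_mult:
  assumes f: "abs_cont_on a b f" and g: "abs_cont_on a b g"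
  shows "abs_cont_on a b (\<lambda>x. f x * g x)"
proof -
  have "bounded (f ` {a..b})" "bounded (g ` {a..b})"
    using assms by (auto intro!: compact_imp_bounded compact_continuous_image abs_cont_on_imp_continuous_on)
  then obtain B C where B: "\<And>x. x \<in> {a..b} \<Longrightarrow> \<bar>f x\<bar> \<le> B" and C: "\<And>x. x \<in> {a..b} \<Longrightarrow> \<bar>g x\<bar> \<le> C"
    unfolding bounded_iff by (metis imageI real_norm_def)
  show ?thesis
  proof (rule abs_cont_on_dominated[OF f g])
    fix u v assume uv: "a \<le> u" "u \<le> v" "v \<le> b"
    have "f v * g v - f u * g u = g v * (f v - f u) + f u * (g v - g u)" by (simp add: algebra_simps)
    also have "\<bar>\<dots>\<bar> \<le> \<bar>g v\<bar> * \<bar>f v - f u\<bar> + \<bar>f u\<bar> * \<bar>g v - g u\<bar>"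
      using abs_triangle_ineq by (metis abs_mult)
    also have "\<dots> \<le> max B C * \<bar>f v - f u\<bar> + max B C * \<bar>g v - g u\<bar>"
    proof (intro add_mono mult_right_mono)
      show "\<bar>g v\<bar> \<le> max B C" using C[of v] uv by simp
      show "\<bar>f u\<bar> \<le> max B C" using B[of u] uv by simp
    qed auto
    finally show "\<bar>f v * g v - f u * g u\<bar> \<le> max B C * (\<bar>f v - f u\<bar> + \<bar>g v - g u\<bar>)"
      by (simp add: algebra_simps)
  qed
qed

lemma abs_cont_on_poly: "abs_cont_on a b (poly p)"
proof (induction p)
  case 0
  show ?case using abs_cont_on_const[of a b 0] by (rule abs_cont_on_cong) simp
next
  case (pCons c p)
  have "abs_cont_on a b (\<lambda>x. c + x * poly p x)"
    by (intro abs_cont_on_add abs_cont_on_mult abs_cont_on_const abs_cont_on_ident pCons)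
  then show ?case by (rule abs_cont_on_cong) simp
qed

lemma abs_cont_on_power:
  "abs_cont_on a b f \<Longrightarrow> abs_cont_on a b (\<lambda>x. f x ^ k)"
  by (induction k) (simp_all add: abs_cont_on_const abs_cont_on_mult)

lemma abs_cont_on_sum:
  "finite S \<Longrightarrow> (\<And>i. i \<in> S \<Longrightarrow> abs_cont_on a b (f i)) \<Longrightarrow> abs_cont_on a b (\<lambda>x. \<Sum>i\<in>S. f i x)"
  by (induction S rule: finite_induct) (simp_all add: abs_cont_on_const abs_cont_on_add)

section \<open>Repeated integration by parts and Taylor's formula\<close>

text \<open>The alternating sum \<open>\<Phi>\<close> is absolutely continuous, and off
  \<open>N\<close> its derivative telescopes to \<open>p * u n\<close>, because \<open>n\<close>
  differentiations kill \<open>p\<close>. So the fundamental theorem is applied only once.\<close>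

theorem higher_integration_by_parts:
  fixes p :: "real poly"
  assumes "a \<le> b" and ac: "\<And>j. j < n \<Longrightarrow> abs_cont_on a b (u j)" and N: "negligible N"
    and deriv: "\<And>j x. j < n \<Longrightarrow> x \<in> {a..b} - N \<Longrightarrow> (u j has_vector_derivative u (Suc j) x) (at x within {a..b})"
    and deg: "degree p < n"
  defines "\<Phi> \<equiv> \<lambda>x. \<Sum>j<n. (-1) ^ j * poly ((pderiv ^^ j) p) x * u (n - 1 - j) x"
  shows "((\<lambda>x. poly p x * u n x) has_integral \<Phi> b - \<Phi> a) {a..b}"
proof (rule has_integral_derivative_abs_cont[OF \<open>a \<le> b\<close> _ N])
  show "abs_cont_on a b \<Phi>"
    unfolding \<Phi>_def using ac
    by (intro abs_cont_on_sum abs_cont_on_mult abs_cont_on_const abs_cont_on_poly) auto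
next
  fix x assume x: "x \<in> {a..b} - N"
  \<comment> \<open>By the product rule the \<open>j\<close>-th summand of \<open>\<Phi>\<close> has
    derivative \<open>c j - c (Suc j)\<close>, the sign coming from the alternating factor.\<close>
  define c where "c j = (-1) ^ j * poly ((pderiv ^^ j) p) x * u (n - j) x" for j
  have "(\<Phi> has_vector_derivative (\<Sum>j<n. c j - c (Suc j))) (at x within {a..b})"
    unfolding \<Phi>_def
  proof (rule has_vector_derivative_sum)
    fix j assume "j \<in> {..<n}"
    then have j: "n - 1 - j < n" "Suc (n - 1 - j) = n - j" by auto
    have u: "(u (n - 1 - j) has_real_derivative u (n - j) x) (at x within {a..b})"
      using deriv[OF j(1) x] j(2) by (simp add: has_real_derivative_iff_has_vector_derivative)
    have "((\<lambda>x. (-1) ^ j * poly ((pderiv ^^ j) p) x * u (n - 1 - j) x) has_real_derivative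
        (-1) ^ j * poly ((pderiv ^^ j) p) x * u (n - j) x
        + (-1) ^ j * poly (pderiv ((pderiv ^^ j) p)) x * u (n - 1 - j) x) (at x within {a..b})"
      by (rule derivative_eq_intros u DERIV_subset[OF poly_DERIV] subset_UNIV refl)+ simp
    then show "((\<lambda>x. (-1) ^ j * poly ((pderiv ^^ j) p) x * u (n - 1 - j) x) has_vector_derivative
        c j - c (Suc j)) (at x within {a..b})"
      unfolding has_real_derivative_iff_has_vector_derivative[symmetric]
      by (rule DERIV_cong) (simp add: c_def)
  qed
  also have "(\<Sum>j<n. c j - c (Suc j)) = c 0 - c n"
    by (rule sum_lessThan_telescope')
  also have "\<dots> = poly p x * u n x"
  proof -
    have "degree ((pderiv ^^ (n - 1)) p) = 0" using deg by (simp add: degree_higher_pderiv)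
    then have "pderiv ((pderiv ^^ (n - 1)) p) = 0" by (simp add: pderiv_eq_0_iff)
    then have "(pderiv ^^ n) p = 0" using deg by (cases n) auto
    then show ?thesis by (simp add: c_def)
  qed
  finally show "(\<Phi> has_vector_derivative poly p x * u n x) (at x within {a..b})" .
qed

text \<open>Divided powers of \<open>c - x\<close>, the kernels of Taylor's formula with integral
  remainder: differentiation lowers the index by one and changes only the sign.\<close>

definition divpow :: "real \<Rightarrow> nat \<Rightarrow> real poly" where
  "divpow c i = smult (1 / fact i) ([:c, -1:] ^ i)"

lemma poly_divpow: "poly (divpow c i) x = (c - x) ^ i / fact i"
  by (simp add: divpow_def)

lemma degree_divpow_le: "degree (divpow c i) \<le> i"
proof -
  have "degree ([:c, -1:] ^ i) \<le> degree [:c, -1:] * i" by (rule degree_power_le)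
  then show ?thesis unfolding divpow_def using degree_smult_le le_trans by fastforce
qed

lemma pderiv_divpow: "pderiv (divpow c (Suc i)) = - divpow c i"
  unfolding divpow_def pderiv_smult pderiv_power_Suc
  by (simp add: pderiv_pCons del: power_Suc of_nat_Suc)

lemma higher_pderiv_divpow:
  "j \<le> i \<Longrightarrow> (pderiv ^^ j) (divpow c i) = smult ((-1) ^ j) (divpow c (i - j))"
proof (induction j)
  case (Suc j)
  then have "i - j = Suc (i - Suc j)" by simp
  with Suc show ?case by (simp add: pderiv_smult pderiv_divpow)
qed simp

lemma higher_pderiv_divpow_eq_0: "i < j \<Longrightarrow> (pderiv ^^ j) (divpow c i) = 0"
proof -
  assume "i < j"
  have "degree ((pderiv ^^ (j - 1)) (divpow c i)) = 0"
    using degree_divpow_le[of c i] \<open>i < j\<close> by (simp add: degree_higher_pderiv)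
  then have "pderiv ((pderiv ^^ (j - 1)) (divpow c i)) = 0" by (simp add: pderiv_eq_0_iff)
  then show ?thesis using \<open>i < j\<close> by (cases j) auto
qed

text \<open>Integrate by parts against \<open>divpow b i\<close>. All boundary terms at
  \<open>a\<close> vanish, and at \<open>b\<close> only the \<open>i\<close>-th derivative of the
  kernel is nonzero, so the index \<open>i\<close> selects the function that is recovered.\<close>

theorem Taylor_integral_abs_cont:
  assumes "a \<le> b" and "\<And>j. j < n \<Longrightarrow> abs_cont_on a b (u j)" and "negligible N"
    and "\<And>j x. j < n \<Longrightarrow> x \<in> {a..b} - N \<Longrightarrow> (u j has_vector_derivative u (Suc j) x) (at x within {a..b})"
    and zero: "\<And>j. j < n \<Longrightarrow> u j a = 0" and i: "i < n"
  shows "((\<lambda>x. (b - x) ^ i / fact i * u n x) has_integral u (n - 1 - i) b) {a..b}"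
proof -
  define \<Phi> where "\<Phi> x = (\<Sum>j<n. (-1) ^ j * poly ((pderiv ^^ j) (divpow b i)) x * u (n - 1 - j) x)" for x
  have "((\<lambda>x. poly (divpow b i) x * u n x) has_integral \<Phi> b - \<Phi> a) {a..b}"
    unfolding \<Phi>_def
    by (rule higher_integration_by_parts[where u = u, OF assms(1,2,3,4)])
      (use degree_divpow_le[of b i] i in auto)
  moreover have "\<Phi> a = 0" unfolding \<Phi>_def using zero i by (intro sum.neutral) auto
  moreover have "\<Phi> b = u (n - 1 - i) b"
  proof -
    have trm: "(-1) ^ j * poly ((pderiv ^^ j) (divpow b i)) b * u (n - 1 - j) b
        = (if j = i then u (n - 1 - i) b else 0)" for j
    proof (cases j i rule: linorder_cases)
      case less
      then show ?thesis by (simp add: higher_pderiv_divpow poly_divpow)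
    next
      case equal
      then show ?thesis by (simp add: higher_pderiv_divpow poly_divpow flip: power_add)
    next
      case greater
      then show ?thesis by (simp add: higher_pderiv_divpow_eq_0)
    qed
    show ?thesis unfolding \<Phi>_def trm using i by simp
  qed
  ultimately show ?thesis by (simp add: poly_divpow)
qed

section \<open>Legendre polynomials on the unit interval\<close>

definition pint :: "real poly \<Rightarrow> real poly" where
  "pint p = (\<Sum>i\<le>degree p. monom (coeff p i / (real i + 1)) (Suc i))"

lemma poly_pint_0: "poly (pint p) 0 = 0"
  by (simp add: pint_def poly_sum poly_monom)

lemma pderiv_pint: "pderiv (pint p) = p"
proof -
  have "pderiv (pint p) = (\<Sum>i\<le>degree p. monom (coeff p i) i)"
    unfolding pint_def higher_pderiv_sum[of 1, simplified]
    by (rule sum.cong) (simp_all add: pderiv_monom add.commute)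
  then show ?thesis by (simp add: poly_as_sum_of_monoms)
qed

lemma poly_eq_if_pderiv_eq:
  fixes p q :: "real poly"
  assumes "pderiv p = pderiv q" "poly p c = poly q c"
  shows "p = q"
proof -
  have "degree (p - q) = 0" using assms(1) by (simp flip: pderiv_eq_0_iff add: pderiv_diff)
  then obtain d where "p - q = [:d:]" by (rule degree_eq_zeroE)
  moreover from this have "d = 0" using assms(2) by (metis poly_diff poly_pCons poly_0 mult_zero_right add_0_right right_minus_eq)
  ultimately show ?thesis by simp
qed

lemma pint_unique: "pderiv q = p \<Longrightarrow> poly q 0 = 0 \<Longrightarrow> pint p = q"
  by (rule poly_eq_if_pderiv_eq[of _ _ 0]) (simp_all add: pderiv_pint poly_pint_0)

lemma pint_diff: "pint (p - q) = pint p - pint q"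
  by (rule pint_unique) (simp_all add: pderiv_diff pderiv_pint poly_pint_0)

lemma pint_smult: "pint (smult c p) = smult c (pint p)"
  by (rule pint_unique) (simp_all add: pderiv_smult pderiv_pint poly_pint_0)

lemma pint_funpow_diff: "(pint ^^ r) (p - q) = (pint ^^ r) p - (pint ^^ r) q"
  by (induction r) (simp_all add: pint_diff)

lemma pint_funpow_smult: "(pint ^^ r) (smult c p) = smult c ((pint ^^ r) p)"
  by (induction r) (simp_all add: pint_smult)

lemma poly_pint_funpow_0: "r > 0 \<Longrightarrow> poly ((pint ^^ r) p) 0 = 0"
  by (cases r) (simp_all add: poly_pint_0)

text \<open>Antidifferentiation from 0 can lose only the Taylor terms of order below
  \<open>r\<close> at 0, and these vanish here.\<close>

lemma pint_funpow_higher_pderiv: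
  "(\<And>i. i < r \<Longrightarrow> poly ((pderiv ^^ i) q) 0 = 0) \<Longrightarrow> (pint ^^ r) ((pderiv ^^ r) q) = q"
proof (induction r)
  case (Suc r)
  have "pint ((pderiv ^^ Suc r) q) = (pderiv ^^ r) q"
    by (rule pint_unique) (use Suc.prems in simp_all)
  then have "(pint ^^ Suc r) ((pderiv ^^ Suc r) q) = (pint ^^ r) ((pderiv ^^ r) q)"
    by (simp add: funpow_swap1)
  then show ?case using Suc by simp
qed simp

text \<open>Cauchy's formula for repeated integration, as an instance of Taylor's formula.\<close>

lemma poly_pint_funpow_integral:
  assumes "0 \<le> x" "r > 0"
  shows "((\<lambda>s. (x - s) ^ (r - 1) / fact (r - 1) * poly p s) has_integral poly ((pint ^^ r) p) x) {0..x}"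
proof -
  \<comment> \<open>\<open>u r\<close> is \<open>p\<close> and \<open>u 0\<close> its
    \<open>r\<close>-fold antiderivative; the members before \<open>u r\<close> vanish at 0.\<close>
  define u where "u j = poly ((pint ^^ (r - j)) p)" for j
  have "((\<lambda>s. (x - s) ^ (r - 1) / fact (r - 1) * u r s) has_integral u (r - 1 - (r - 1)) x) {0..x}"
  proof (rule Taylor_integral_abs_cont[where N = "{}"])
    fix j s assume "j < r"
    then have "r - j = Suc (r - Suc j)" by simp
    then have "pderiv ((pint ^^ (r - j)) p) = (pint ^^ (r - Suc j)) p"
      by (simp add: pderiv_pint)
    then have "(u j has_real_derivative u (Suc j) s) (at s within {0..x})"
      unfolding u_def by (metis DERIV_subset poly_DERIV subset_UNIV)
    then show "(u j has_vector_derivative u (Suc j) s) (at s within {0..x})"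
      by (simp add: has_real_derivative_iff_has_vector_derivative)
  qed (use assms in \<open>auto simp: u_def poly_pint_funpow_0 abs_cont_on_poly\<close>)
  then show ?thesis by (simp add: u_def)
qed

section \<open>Legendre polynomials through the formula of Rodrigues\<close>

definition sqp :: "real poly" where
  "sqp = [:0, -1, 1:]"

text \<open>Rodrigues' formula for the Legendre polynomials shifted to \<open>{0..1}\<close>,
  normalised to the value 1 at 1.\<close>

definition leg :: "nat \<Rightarrow> real poly" where
  "leg j = smult (1 / fact j) ((pderiv ^^ j) (sqp ^ j))"

lemma poly_sqp: "poly sqp x = x\<^sup>2 - x"
  by (simp add: sqp_def power2_eq_square algebra_simps)

text \<open>Each derivative removes one factor \<open>x - c\<close>. Keeping track of the cofactor
  at \<open>c\<close> serves two purposes: derivatives of order \<open>i < k\<close> vanish at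
  \<open>c\<close>, and \<open>i = k\<close> gives the endpoint values of
  \<open>leg\<close>.\<close>

lemma higher_pderiv_root_power:
  fixes q :: "real poly"
  shows "i \<le> k \<Longrightarrow> \<exists>r. (pderiv ^^ i) ([:-c, 1:] ^ k * q) = [:-c, 1:] ^ (k - i) * r
    \<and> poly r c = fact k / fact (k - i) * poly q c"
proof (induction i)
  case (Suc i)
  then obtain r where r: "(pderiv ^^ i) ([:-c, 1:] ^ k * q) = [:-c, 1:] ^ (k - i) * r"
    "poly r c = fact k / fact (k - i) * poly q c" by auto
  define l where "l = k - Suc i"
  have l: "k - i = Suc l" using Suc.prems by (simp add: l_def)
  have "(pderiv ^^ Suc i) ([:-c, 1:] ^ k * q) = pderiv ([:-c, 1:] ^ Suc l * r)"
    using r(1) by (simp add: l del: power_Suc)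
  also have "\<dots> = [:-c, 1:] ^ l * (smult (of_nat (Suc l)) r + [:-c, 1:] * pderiv r)"
    unfolding pderiv_mult pderiv_power_Suc
    by (simp add: pderiv_pCons algebra_simps)
  finally have "(pderiv ^^ Suc i) ([:-c, 1:] ^ k * q) =
      [:-c, 1:] ^ (k - Suc i) * (smult (of_nat (Suc l)) r + [:-c, 1:] * pderiv r)"
    by (simp add: l_def)
  moreover have "poly (smult (of_nat (Suc l)) r + [:-c, 1:] * pderiv r) c
      = fact k / fact (k - Suc i) * poly q c"
    by (simp add: r(2) l del: of_nat_Suc flip: l_def)
  ultimately show ?case by blast
qed (auto intro: exI[of _ q])

text \<open>The roots are written \<open>- 0\<close> and \<open>- 1\<close>, each in front once, to
  match the shape \<open>[:-c, 1:] ^ k * q\<close>.\<close>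

lemma sqp_power: "sqp ^ j = [:- 0, 1:] ^ j * [:- 1, 1:] ^ j" "sqp ^ j = [:- 1, 1:] ^ j * [:- 0, 1:] ^ j"
  by (simp_all add: sqp_def flip: power_mult_distrib)

lemma higher_pderiv_sqp_power_eq_0:
  assumes "i < j" "c = 0 \<or> c = 1"
  shows "poly ((pderiv ^^ i) (sqp ^ j)) c = 0"
proof -
  obtain q where "sqp ^ j = [:- c, 1:] ^ j * q" using assms(2) sqp_power[of j] by blast
  then obtain r where "(pderiv ^^ i) (sqp ^ j) = [:-c, 1:] ^ (j - i) * r"
    using higher_pderiv_root_power[of i j c q] assms(1) by auto
  then show ?thesis using assms(1) by simp
qed

lemma poly_leg_0: "poly (leg j) 0 = (-1) ^ j"
  using higher_pderiv_root_power[of j j 0 "[:- 1, 1:] ^ j"]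
  by (auto simp: leg_def sqp_power(1))

lemma poly_leg_1: "poly (leg j) 1 = 1"
  using higher_pderiv_root_power[of j j 1 "[:- 0, 1:] ^ j"]
  by (auto simp: leg_def sqp_power(2))

lemma degree_leg: "degree (leg j) = j"
  by (simp add: leg_def degree_higher_pderiv degree_power_eq sqp_def)

lemma leg_0: "leg 0 = 1"
  by (simp add: leg_def)

lemma leg_1: "leg (Suc 0) = [:-1, 2:]"
  by (simp add: leg_def sqp_def pderiv_pCons)

lemma pderiv_sqp: "pderiv sqp = [:-1, 2:]"
  by (simp add: sqp_def pderiv_pCons)

text \<open>Since the square of \<open>2 * x - 1\<close> is 4 times \<open>sqp\<close> plus 1, the
  second derivative is again a combination of powers of \<open>sqp\<close>. This yields the
  recurrence below and later the last Legendre coefficient for \<open>k = 3\<close>.\<close>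

lemma pderiv2_sqp_power:
  "pderiv (pderiv (sqp ^ Suc (Suc j))) =
    smult (real (Suc (Suc j))) (smult (2 * (2 * real j + 3)) (sqp ^ Suc j) + smult (real (Suc j)) (sqp ^ j))"
proof -
  have d2: "pderiv [:-1, 2::real:] = [:2:]" by (simp add: pderiv_pCons)
  have sq: "[:-1, 2::real:] * [:-1, 2:] = smult 4 sqp + 1"
    by (simp add: sqp_def one_pCons)
  have "pderiv (pderiv (sqp ^ Suc (Suc j))) = smult (real (Suc (Suc j)))
     (smult 2 (sqp ^ Suc j) + smult (real (Suc j)) (sqp ^ j * ([:-1, 2:] * [:-1, 2:])))"
    unfolding pderiv_power_Suc pderiv_sqp pderiv_mult pderiv_smult d2
    by (intro poly_eq_poly_eq_iff[THEN iffD1] ext) (simp add: algebra_simps)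
  also have "sqp ^ j * ([:-1, 2:] * [:-1, 2:]) = smult 4 (sqp ^ Suc j) + sqp ^ j"
    unfolding sq by (simp add: algebra_simps)
  finally show ?thesis
    by (simp only:) (intro poly_eq_poly_eq_iff[THEN iffD1] ext, simp add: algebra_simps)
qed

text \<open>Differentiate \<open>pderiv2_sqp_power\<close> another \<open>j + 1\<close> times and
  read each term by Rodrigues' formula.\<close>

lemma leg_recurrence:
  "smult (2 * (2 * real j + 3)) (leg (Suc j)) = pderiv (leg (Suc (Suc j))) - pderiv (leg j)"
proof -
  have "pderiv (leg (Suc (Suc j))) = smult (1 / fact (Suc (Suc j)))
     ((pderiv ^^ Suc j) (pderiv (pderiv (sqp ^ Suc (Suc j)))))"
    unfolding leg_def pderiv_smult by (simp add: funpow_swap1)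
  also have "\<dots> = smult (1 / fact (Suc (Suc j))) (smult (real (Suc (Suc j)))
      (smult (2 * (2 * real j + 3)) ((pderiv ^^ Suc j) (sqp ^ Suc j)) +
       smult (real (Suc j)) ((pderiv ^^ Suc j) (sqp ^ j))))"
    unfolding pderiv2_sqp_power higher_pderiv_smult higher_pderiv_add ..
  also have "\<dots> = smult (2 * (2 * real j + 3)) (leg (Suc j)) + pderiv (leg j)"
    unfolding leg_def pderiv_smult smult_add_right smult_smult
    by (simp add: fact_Suc del: of_nat_Suc power_Suc)
  finally show ?thesis by simp
qed

section \<open>Orthogonality and norms of the Legendre polynomials\<close>

lemma poly_has_vector_derivative:
  "(poly p has_vector_derivative poly (pderiv p) x) (at x within S)"
  unfolding has_real_derivative_iff_has_vector_derivative[symmetric]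
  by (rule DERIV_subset[OF poly_DERIV subset_UNIV])

lemma pderiv_has_integral:
  fixes p :: "real poly"
  assumes "a \<le> b"
  shows "(poly (pderiv p) has_integral poly p b - poly p a) {a..b}"
  by (rule fundamental_theorem_of_calculus[OF assms poly_has_vector_derivative])

text \<open>Integrate by parts \<open>j\<close> times: the boundary terms contain derivatives of
  \<open>sqp ^ j\<close> of order below \<open>j\<close>, which vanish at 0 and 1.\<close>

lemma leg_orthogonal_lower_degree:
  assumes "degree q < j"
  shows "((\<lambda>x. poly q x * poly (leg j) x) has_integral 0) {0..1}"
proof -
  define u where "u i = poly (smult (1 / fact j) ((pderiv ^^ i) (sqp ^ j)))" for i
  define \<Phi> where "\<Phi> x = (\<Sum>i<j. (-1) ^ i * poly ((pderiv ^^ i) q) x * u (j - 1 - i) x)" for x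
  have "((\<lambda>x. poly q x * u j x) has_integral \<Phi> 1 - \<Phi> 0) {0..1}"
    unfolding \<Phi>_def
  proof (rule higher_integration_by_parts[where N = "{}"])
    fix i x
    show "(u i has_vector_derivative u (Suc i) x) (at x within {0..1})"
      using poly_has_vector_derivative[of "smult (1 / fact j) ((pderiv ^^ i) (sqp ^ j))" x]
      by (simp add: u_def pderiv_smult del: poly_smult)
    show "abs_cont_on 0 1 (u i)" unfolding u_def by (rule abs_cont_on_poly)
  qed (use assms in auto)
  moreover have "\<Phi> 1 = 0" "\<Phi> 0 = 0"
    by (auto simp: \<Phi>_def u_def higher_pderiv_sqp_power_eq_0 intro!: sum.neutral)
  ultimately show ?thesis by (simp add: u_def leg_def)
qed

lemma leg_orthogonal:
  assumes "i \<noteq> j"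
  shows "((\<lambda>x. poly (leg i) x * poly (leg j) x) has_integral 0) {0..1}"
proof (cases "i < j")
  case True
  then show ?thesis by (intro leg_orthogonal_lower_degree) (simp add: degree_leg)
next
  case False
  then have "((\<lambda>x. poly (leg j) x * poly (leg i) x) has_integral 0) {0..1}"
    using assms by (intro leg_orthogonal_lower_degree) (simp add: degree_leg)
  then show ?thesis by (simp add: mult.commute)
qed

text \<open>For \<open>j > 0\<close>, integrate the derivative of
  \<open>leg j * leg (Suc j)\<close>. Orthogonality removes the term that differentiates
  \<open>leg j\<close>; in the other one the recurrence leaves a multiple of the square of
  \<open>leg j\<close>.\<close>

lemma leg_norm:
  "((\<lambda>x. poly (leg j) x * poly (leg j) x) has_integral 1 / (2 * real j + 1)) {0..1}"
proof (cases j)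
  case 0
  then show ?thesis using has_integral_const_real[of "1::real" 0 1] by (simp add: leg_0)
next
  case (Suc i)
  define p where "p = leg (Suc i)"
  define q where "q = leg (Suc (Suc i))"
  have "(poly (pderiv (p * q)) has_integral poly (p * q) 1 - poly (p * q) 0) {0..1}"
    by (rule pderiv_has_integral) simp
  moreover have "poly (pderiv (p * q)) = (\<lambda>x. poly p x * poly (pderiv q) x + poly (pderiv p) x * poly q x)"
    by (rule ext) (simp add: pderiv_mult algebra_simps)
  \<comment> \<open>The product is 1 at 1 and -1 at 0, where consecutive Legendre polynomials have
    opposite signs.\<close>
  moreover have "poly (p * q) 1 - poly (p * q) 0 = 2"
    by (simp add: p_def q_def poly_leg_0 poly_leg_1 algebra_simps flip: power_add)
  ultimately have pq: "((\<lambda>x. poly p x * poly (pderiv q) x + poly (pderiv p) x * poly q x) has_integral 2) {0..1}"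
    by simp
  have "((\<lambda>x. poly (pderiv p) x * poly q x) has_integral 0) {0..1}"
    unfolding q_def by (rule leg_orthogonal_lower_degree) (simp add: p_def degree_pderiv degree_leg)
  from has_integral_diff[OF pq this]
  have 1: "((\<lambda>x. poly p x * poly (pderiv q) x) has_integral 2) {0..1}" by simp
  have 2: "((\<lambda>x. poly (pderiv (leg i)) x * poly p x) has_integral 0) {0..1}"
    unfolding p_def by (rule leg_orthogonal_lower_degree) (simp add: degree_pderiv degree_leg)
  have "poly p x * poly (pderiv q) x - poly (pderiv (leg i)) x * poly p x
      = 2 * (2 * real i + 3) * (poly p x * poly p x)" for x
  proof -
    have "poly (pderiv q) x - poly (pderiv (leg i)) x = 2 * (2 * real i + 3) * poly p x"
      using arg_cong[OF leg_recurrence[of i], of "\<lambda>r. poly r x"] by (simp add: p_def q_def)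
    then have "poly p x * (poly (pderiv q) x - poly (pderiv (leg i)) x)
        = poly p x * (2 * (2 * real i + 3) * poly p x)" by simp
    then show ?thesis by (simp add: algebra_simps)
  qed
  moreover define k where "k = 2 * (2 * real i + 3)"
  ultimately have "((\<lambda>x. k * (poly p x * poly p x)) has_integral 2) {0..1}"
    using has_integral_diff[OF 1 2] by simp
  from has_integral_mult_right[OF this, of "1 / k"]
  have "((\<lambda>x. poly p x * poly p x) has_integral 2 / k) {0..1}"
    by (simp add: k_def add_pos_pos less_imp_neq[symmetric])
  moreover have "2 / k = 1 / (2 * real j + 1)" by (simp add: k_def Suc field_simps)
  ultimately show ?thesis by (simp add: Suc p_def)
qed

text \<open>\<open>leg n\<close> has degree exactly \<open>n\<close>, so subtracting a multiple of
  it lowers the degree of \<open>q\<close> and the induction goes on.\<close>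

lemma leg_span:
  assumes "\<And>j. j < n \<Longrightarrow> ((\<lambda>x. g x * poly (leg j) x) has_integral 0) {0..1}" and "degree q < n"
  shows "((\<lambda>x. g x * poly q x) has_integral 0) {0..1}"
  using assms
proof (induction n arbitrary: q)
  case (Suc n)
  define c where "c = coeff q n / coeff (leg n) n"
  define r where "r = q - smult c (leg n)"
  have "coeff (leg n) n \<noteq> 0"
    using poly_leg_1[of n] degree_leg[of n] leading_coeff_0_iff[of "leg n"] by auto
  then have "coeff r n = 0" by (simp add: r_def c_def)
  moreover have "degree r \<le> n"
    using Suc.prems(2) degree_diff_le[of q n "smult c (leg n)"] by (simp add: r_def degree_leg)
  \<comment> \<open>No degree is below \<open>n = 0\<close>, so \<open>r = 0\<close> is a case of
    its own.\<close>
  ultimately have "r = 0 \<or> degree r < n"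
    by (metis le_neq_implies_less leading_coeff_0_iff)
  then have "((\<lambda>x. g x * poly r x) has_integral 0) {0..1}"
    using Suc by auto
  from has_integral_add[OF this has_integral_mult_right[OF Suc.prems(1)[of n], of c]]
  show ?case by (simp add: r_def algebra_simps)
qed simp

section \<open>Iterated antiderivatives of the Legendre polynomials\<close>

lemma pint_funpow_1: "(pint ^^ r) 1 = monom (1 / fact r) r"
proof (induction r)
  case (Suc r)
  have "pint (monom (1 / fact r) r) = monom (1 / fact (Suc r)) (Suc r)"
    by (rule pint_unique) (simp_all add: pderiv_monom poly_monom field_simps del: of_nat_Suc)
  with Suc show ?case by simp
qed (simp add: monom_0 one_pCons)

text \<open>The antiderivatives cancel \<open>r\<close> of the \<open>j\<close> derivatives in
  Rodrigues' formula, without constants of integration since the lower derivatives of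
  \<open>sqp ^ j\<close> vanish at 0.\<close>

lemma pint_funpow_leg:
  assumes "r \<le> j"
  shows "(pint ^^ r) (leg j) = smult (1 / fact j) ((pderiv ^^ (j - r)) (sqp ^ j))"
proof -
  have "(pderiv ^^ j) (sqp ^ j) = (pderiv ^^ r) ((pderiv ^^ (j - r)) (sqp ^ j))"
    using assms by (simp flip: funpow_add comp_apply[of "pderiv ^^ r"])
  moreover have "(pint ^^ r) \<dots> = (pderiv ^^ (j - r)) (sqp ^ j)"
  proof (rule pint_funpow_higher_pderiv)
    fix i assume "i < r"
    then have "i + (j - r) < j" using assms by simp
    then have "poly ((pderiv ^^ (i + (j - r))) (sqp ^ j)) 0 = 0"
      by (intro higher_pderiv_sqp_power_eq_0) auto
    then show "poly ((pderiv ^^ i) ((pderiv ^^ (j - r)) (sqp ^ j))) 0 = 0"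
      by (simp add: funpow_add)
  qed
  ultimately show ?thesis by (simp add: leg_def pint_funpow_smult)
qed

text \<open>The recurrence integrated from 0; no constant appears because
  \<open>leg (Suc (Suc j))\<close> and \<open>leg j\<close> agree at 0.\<close>

lemma pint_leg_recurrence:
  "smult (2 * (2 * real j + 3)) (pint (leg (Suc j))) = leg (Suc (Suc j)) - leg j"
  unfolding pint_smult[symmetric] leg_recurrence
  by (rule pint_unique) (simp_all add: pderiv_diff poly_leg_0)

lemma pderiv_square: "pderiv (p\<^sup>2) = smult 2 (p * pderiv p)"
  for p :: "real poly"
  by (intro poly_eq_poly_eq_iff[THEN iffD1] ext) (simp add: power2_eq_square pderiv_mult)

text \<open>The derivative of the sum telescopes because twice \<open>2 * j + 1\<close> times the antiderivative of
  \<open>leg j\<close> is \<open>leg (j + 1) - leg (j - 1)\<close>.\<close>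

lemma sum_pint_leg_squares:
  "(\<Sum>j<Suc l. smult (2 * real j + 1) (((pint ^^ Suc l) (leg j))\<^sup>2)) =
    monom (1 / ((2 * real l + 1) * (fact l)\<^sup>2)) (2 * l + 1)
    + smult (1 / ((2 * real l + 1) * (fact l)\<^sup>2)) (sqp ^ (2 * l + 1))"
  (is "?S = ?R")
proof (rule poly_eq_if_pderiv_eq[of _ _ 0])
  define w where "w j = (pint ^^ l) (leg j)" for j
  have pint_w: "(pint ^^ Suc l) (leg j) = (pint ^^ l) (pint (leg j))" for j
    by (simp add: funpow_swap1)
  have tel: "(\<Sum>j<Suc k. smult (2 * (2 * real j + 1)) ((pint ^^ Suc l) (leg j) * w j))
      = w (Suc k) * w k + (w 0)\<^sup>2" for k
  proof (induction k)
    case 0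
    \<comment> \<open>\<open>leg 0\<close> has no predecessor. Instead \<open>2 * x\<close> is
      \<open>leg 1 + leg 0\<close>, and the second summand produces the square of
      \<open>w 0\<close>.\<close>
    have "pint 1 = [:0, 1:]" by (rule pint_unique) (simp_all add: pderiv_pCons one_pCons)
    then have "leg (Suc 0) = smult 2 (pint (leg 0)) - leg 0" by (simp add: leg_0 leg_1 one_pCons)
    then have "w (Suc 0) = smult 2 ((pint ^^ Suc l) (leg 0)) - w 0"
      unfolding pint_w w_def by (simp add: pint_funpow_diff pint_funpow_smult)
    then show ?case by (simp add: left_diff_distrib power2_eq_square del: funpow.simps)
  next
    case (Suc k)
    have "smult (2 * (2 * real k + 3)) ((pint ^^ Suc l) (leg (Suc k))) = w (Suc (Suc k)) - w k"
      unfolding pint_w w_def by (simp only: pint_funpow_diff pint_funpow_smult[symmetric] pint_leg_recurrence)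
    moreover have "2 * (2 * real (Suc k) + 1) = 2 * (2 * real k + 3)" by simp
    ultimately have "smult (2 * (2 * real (Suc k) + 1)) ((pint ^^ Suc l) (leg (Suc k)) * w (Suc k))
        = (w (Suc (Suc k)) - w k) * w (Suc k)"
      by (simp only: mult_smult_left[symmetric])
    with Suc show ?case by (simp add: algebra_simps del: funpow.simps)
  qed
  have "pderiv ?S = (\<Sum>j<Suc l. smult (2 * (2 * real j + 1)) ((pint ^^ Suc l) (leg j) * w j))"
    unfolding higher_pderiv_sum[of 1, simplified]
    by (rule sum.cong) (simp_all add: pderiv_smult pderiv_square pderiv_pint w_def algebra_simps)
  also have "\<dots> = w (Suc l) * w l + (w 0)\<^sup>2" by (rule tel)
  \<comment> \<open>Rodrigues' formula leaves no derivative in \<open>w l\<close> and one in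
    \<open>w (Suc l)\<close>, so their product is a multiple of the derivative of
    \<open>sqp ^ (2 * l + 1)\<close>.\<close>
  also have "w l = smult (1 / fact l) (sqp ^ l)" by (simp add: w_def pint_funpow_leg)
  also have "w (Suc l) = smult (1 / fact l) (sqp ^ l * pderiv sqp)"
  proof -
    have "w (Suc l) = smult (1 / fact (Suc l)) (pderiv (sqp ^ Suc l))"
      by (simp add: w_def pint_funpow_leg del: power_Suc)
    then show ?thesis by (simp add: pderiv_power_Suc field_simps del: power_Suc of_nat_Suc)
  qed
  also have "(w 0)\<^sup>2 = monom (1 / (fact l)\<^sup>2) (2 * l)"
    by (simp add: w_def leg_0 pint_funpow_1 power2_eq_square mult_monom mult_2)
  also have "smult (1 / fact l) (sqp ^ l * pderiv sqp) * smult (1 / fact l) (sqp ^ l) + monom (1 / (fact l)\<^sup>2) (2 * l)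
      = pderiv ?R"
  proof -
    have "pderiv (sqp ^ (2 * l + 1)) = smult (2 * real l + 1) (sqp ^ (2 * l) * pderiv sqp)"
      using pderiv_power_Suc[of sqp "2 * l"] by (simp add: algebra_simps)
    moreover have "pderiv (monom (1 / ((2 * real l + 1) * (fact l)\<^sup>2)) (2 * l + 1)) = monom (1 / (fact l)\<^sup>2) (2 * l)"
      by (simp add: pderiv_monom add.commute)
    moreover have "1 / ((2 * real l + 1) * (fact l)\<^sup>2) * (2 * real l + 1) = 1 / (fact l)\<^sup>2"
      by (simp add: add_nonneg_eq_0_iff)
    ultimately have "pderiv ?R = monom (1 / (fact l)\<^sup>2) (2 * l) + smult (1 / (fact l)\<^sup>2) (sqp ^ (2 * l) * pderiv sqp)"
      by (simp only: pderiv_add pderiv_smult smult_smult)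
    moreover have "smult (1 / fact l) (sqp ^ l * pderiv sqp) * smult (1 / fact l) (sqp ^ l)
        = smult (1 / (fact l)\<^sup>2) (sqp ^ (2 * l) * pderiv sqp)"
      by (simp add: power2_eq_square mult_2 power_add mult.assoc mult.commute[of "pderiv sqp"])
    ultimately show ?thesis by simp
  qed
  finally show "pderiv ?S = pderiv ?R" .
  show "poly ?S 0 = poly ?R 0"
    by (simp add: poly_sum poly_monom poly_sqp poly_pint_0)
qed

section \<open>The extremal problem\<close>

text \<open>\<open>trunc_pow a l\<close> represents the functional \<open>f \<mapsto> D k f a\<close> with \<open>k = n - Suc l\<close>, in the sense that
  its \<open>L\<^sub>2\<close> inner product with \<open>D n f\<close> is \<open>D k f a\<close> for \<open>f \<in> W0 n\<close>. Its Legendre coefficients are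
  \<open>pint_coeff a l j\<close>, \<open>leg_proj a l n\<close> is its projection to the polynomials of degree less than \<open>n\<close>,
  and \<open>extremal_sq a l n\<close> is its squared distance from them.\<close>

definition trunc_pow :: "real \<Rightarrow> nat \<Rightarrow> real \<Rightarrow> real" where
  "trunc_pow a l x = (if x \<le> a then (a - x) ^ l / fact l else 0)"

definition pint_coeff :: "real \<Rightarrow> nat \<Rightarrow> nat \<Rightarrow> real" where
  "pint_coeff a l j = poly ((pint ^^ Suc l) (leg j)) a"

definition leg_proj :: "real \<Rightarrow> nat \<Rightarrow> nat \<Rightarrow> real poly" where
  "leg_proj a l n = (\<Sum>j<n. smult ((2 * real j + 1) * pint_coeff a l j) (leg j))"

definition extremal_sq :: "real \<Rightarrow> nat \<Rightarrow> nat \<Rightarrow> real" where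
  "extremal_sq a l n = a ^ (2 * l + 1) / ((2 * real l + 1) * (fact l)\<^sup>2)
     - (\<Sum>j<n. (2 * real j + 1) * (pint_coeff a l j)\<^sup>2)"

section \<open>Projection of the truncated power to polynomials\<close>

lemma trunc_pow_has_integral:
  assumes "0 \<le> a" "a \<le> 1" "((\<lambda>x. (a - x) ^ l / fact l * f x) has_integral y) {0..a}"
  shows "((\<lambda>x. trunc_pow a l x * f x) has_integral y) {0..1}"
proof -
  have "((\<lambda>x. if x \<in> {0..a} then (a - x) ^ l / fact l * f x else 0) has_integral y) {0..1}"
    using assms by (subst has_integral_restrict) auto
  then show ?thesis
    by (rule has_integral_eq[rotated]) (auto simp: trunc_pow_def)
qed

lemma trunc_pow_leg_integral:
  assumes "0 \<le> a" "a \<le> 1"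
  shows "((\<lambda>x. trunc_pow a l x * poly (leg j) x) has_integral pint_coeff a l j) {0..1}"
  using poly_pint_funpow_integral[OF assms(1), of "Suc l" "leg j"]
  by (intro trunc_pow_has_integral[OF assms]) (simp add: pint_coeff_def)

lemma trunc_pow_square_integral:
  assumes "0 \<le> a" "a \<le> 1"
  shows "((\<lambda>x. trunc_pow a l x * trunc_pow a l x) has_integral
    a ^ (2 * l + 1) / ((2 * real l + 1) * (fact l)\<^sup>2)) {0..1}"
proof (rule trunc_pow_has_integral[OF assms])
  \<comment> \<open>An antiderivative of the square of the kernel.\<close>
  define p where "p = smult (- 1 / ((2 * real l + 1) * (fact l)\<^sup>2)) ([:a, -1:] ^ Suc (2 * l))"
  have "poly (pderiv p) = (\<lambda>x. (a - x) ^ l / fact l * ((a - x) ^ l / fact l))"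
  proof
    fix x
    define c where "c = 2 * real l + 1"
    have "c > 0" by (simp add: c_def)
    have "real (Suc (2 * l)) = c" by (simp add: c_def)
    then have "poly (pderiv p) x = 1 / (c * (fact l)\<^sup>2) * (c * (a - x) ^ (2 * l))"
      unfolding p_def pderiv_smult pderiv_power_Suc c_def[symmetric]
      by (simp add: pderiv_pCons del: of_nat_Suc)
    also have "\<dots> = (a - x) ^ l / fact l * ((a - x) ^ l / fact l)"
      using \<open>c > 0\<close> by (simp add: power2_eq_square mult_2 power_add)
    finally show "poly (pderiv p) x = (a - x) ^ l / fact l * ((a - x) ^ l / fact l)" .
  qed
  then have "((\<lambda>x. (a - x) ^ l / fact l * ((a - x) ^ l / fact l)) has_integral poly p a - poly p 0) {0..a}"
    using pderiv_has_integral[OF assms(1), of p] by simp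
  moreover have "poly p a - poly p 0 = a ^ (2 * l + 1) / ((2 * real l + 1) * (fact l)\<^sup>2)"
    by (simp add: p_def)
  ultimately have "((\<lambda>x. (a - x) ^ l / fact l * ((a - x) ^ l / fact l)) has_integral
    a ^ (2 * l + 1) / ((2 * real l + 1) * (fact l)\<^sup>2)) {0..a}" by simp
  then show "((\<lambda>x. (a - x) ^ l / fact l * trunc_pow a l x) has_integral
    a ^ (2 * l + 1) / ((2 * real l + 1) * (fact l)\<^sup>2)) {0..a}"
    by (rule has_integral_eq[rotated]) (simp add: trunc_pow_def)
qed

lemma degree_leg_proj:
  assumes "n > 0"
  shows "degree (leg_proj a l n) < n"
proof -
  have "degree (leg_proj a l n) \<le> n - 1"
    unfolding leg_proj_def
    by (rule degree_sum_le) (use assms in \<open>auto simp: degree_leg intro: order_trans[OF degree_smult_le]\<close>)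
  then show ?thesis using assms by linarith
qed

text \<open>Orthogonality leaves the term \<open>j = i\<close>, where the factor
  \<open>2 * i + 1\<close> cancels the squared norm of \<open>leg i\<close>.\<close>

lemma leg_proj_leg_integral:
  assumes "i < n"
  shows "((\<lambda>x. poly (leg_proj a l n) x * poly (leg i) x) has_integral pint_coeff a l i) {0..1}"
proof -
  have "((\<lambda>x. \<Sum>j<n. (2 * real j + 1) * pint_coeff a l j * (poly (leg j) x * poly (leg i) x)) has_integral
      (\<Sum>j<n. if j = i then pint_coeff a l j else 0)) {0..1}"
  proof (rule has_integral_sum)
    fix j
    show "((\<lambda>x. (2 * real j + 1) * pint_coeff a l j * (poly (leg j) x * poly (leg i) x)) has_integral
      (if j = i then pint_coeff a l j else 0)) {0..1}"
    proof (cases "j = i")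
      case True
      have "2 * real i + 1 \<noteq> 0" by linarith
      then show ?thesis
        using has_integral_mult_right[OF leg_norm[of i], of "(2 * real i + 1) * pint_coeff a l i"] True by simp
    next
      case False
      then show ?thesis
        using has_integral_mult_right[OF leg_orthogonal[OF False], of "(2 * real j + 1) * pint_coeff a l j"] by simp
    qed
  qed simp
  then show ?thesis
    using assms by (simp add: leg_proj_def poly_sum sum_distrib_right mult.assoc)
qed

text \<open>\<open>trunc_pow\<close> and its projection have the same first \<open>n\<close>
  Legendre coefficients, and \<open>leg_span\<close> passes from these to all
  \<open>q\<close>.\<close>

lemma remainder_orthogonal:
  assumes "0 \<le> a" "a \<le> 1" "degree q < n"
  shows "((\<lambda>x. (trunc_pow a l x - poly (leg_proj a l n) x) * poly q x) has_integral 0) {0..1}"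
proof (rule leg_span[OF _ assms(3)])
  fix j assume "j < n"
  from has_integral_diff[OF trunc_pow_leg_integral[OF assms(1,2), of l j] leg_proj_leg_integral[OF this, of a l]]
  show "((\<lambda>x. (trunc_pow a l x - poly (leg_proj a l n) x) * poly (leg j) x) has_integral 0) {0..1}"
    by (simp add: left_diff_distrib)
qed

text \<open>The squared norm of \<open>trunc_pow\<close> minus its inner product with the
  projection. It serves twice: for the norm of the remainder and for the value of the extremal
  function at \<open>a\<close>.\<close>

lemma remainder_trunc_pow_integral:
  assumes "0 \<le> a" "a \<le> 1"
  shows "((\<lambda>x. (trunc_pow a l x - poly (leg_proj a l n) x) * trunc_pow a l x) has_integral extremal_sq a l n) {0..1}"
proof -
  have "((\<lambda>x. \<Sum>j<n. (2 * real j + 1) * pint_coeff a l j * (trunc_pow a l x * poly (leg j) x)) has_integral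
      (\<Sum>j<n. (2 * real j + 1) * pint_coeff a l j * pint_coeff a l j)) {0..1}"
    by (intro has_integral_sum has_integral_mult_right trunc_pow_leg_integral assms) simp
  moreover have "(\<Sum>j<n. (2 * real j + 1) * pint_coeff a l j * (trunc_pow a l x * poly (leg j) x))
      = poly (leg_proj a l n) x * trunc_pow a l x" for x
    unfolding leg_proj_def poly_sum sum_distrib_right by (rule sum.cong) (simp_all add: mult_ac)
  moreover have "(\<Sum>j<n. (2 * real j + 1) * pint_coeff a l j * pint_coeff a l j)
      = (\<Sum>j<n. (2 * real j + 1) * (pint_coeff a l j)\<^sup>2)"
    by (simp add: power2_eq_square mult.assoc)
  ultimately have "((\<lambda>x. poly (leg_proj a l n) x * trunc_pow a l x) has_integral
      (\<Sum>j<n. (2 * real j + 1) * (pint_coeff a l j)\<^sup>2)) {0..1}" by simp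
  from has_integral_diff[OF trunc_pow_square_integral[OF assms, of l] this]
  show ?thesis by (simp only: left_diff_distrib extremal_sq_def)
qed

text \<open>Pythagoras: the remainder is orthogonal to the projection, so only its product with
  \<open>trunc_pow\<close> is left.\<close>

lemma remainder_square_integral:
  assumes "0 \<le> a" "a \<le> 1" "n > 0"
  shows "((\<lambda>x. (trunc_pow a l x - poly (leg_proj a l n) x)\<^sup>2) has_integral extremal_sq a l n) {0..1}"
  using has_integral_diff[OF remainder_trunc_pow_integral[OF assms(1,2)]
      remainder_orthogonal[OF assms(1,2) degree_leg_proj[OF assms(3)]]]
  by (simp add: power2_eq_square right_diff_distrib)

section \<open>The upper bound\<close>

lemma has_integral_Cauchy_Schwarz:
  fixes f g :: "real \<Rightarrow> real"
  assumes f: "((\<lambda>x. (f x)\<^sup>2) has_integral F) S" and g: "((\<lambda>x. (g x)\<^sup>2) has_integral G) S"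
    and fg: "((\<lambda>x. f x * g x) has_integral y) S"
  shows "y\<^sup>2 \<le> F * G"
proof -
  have F: "F \<ge> 0" using f by (rule has_integral_nonneg) simp
  have quad: "0 \<le> G - 2 * s * y + s\<^sup>2 * F" for s
  proof -
    have "((\<lambda>x. (g x)\<^sup>2 - 2 * s * (f x * g x) + s\<^sup>2 * (f x)\<^sup>2) has_integral G - 2 * s * y + s\<^sup>2 * F) S"
      by (intro has_integral_add has_integral_diff has_integral_mult_right f g fg)
    moreover have "(g x)\<^sup>2 - 2 * s * (f x * g x) + s\<^sup>2 * (f x)\<^sup>2 = (g x - s * f x)\<^sup>2" for x
      by (simp add: power2_eq_square algebra_simps)
    ultimately have "((\<lambda>x. (g x - s * f x)\<^sup>2) has_integral G - 2 * s * y + s\<^sup>2 * F) S" by simp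
    then show ?thesis by (rule has_integral_nonneg) simp
  qed
  show ?thesis
  proof (cases "F = 0")
    case True
    have "y = 0"
    proof (rule ccontr)
      \<comment> \<open>For \<open>F = 0\<close> the quadratic is linear in \<open>s\<close>, and at
        this \<open>s\<close> its value would be -1.\<close>
      assume "y \<noteq> 0"
      then show False using quad[of "(G + 1) / (2 * y)"] True by simp
    qed
    then show ?thesis using True by simp
  next
    case False
    \<comment> \<open>The quadratic is minimal at \<open>s = y / F\<close>.\<close>
    then show ?thesis using quad[of "y / F"] F by (simp add: power2_eq_square field_simps)
  qed
qed

text \<open>One null set serves all orders, since only the derivative of order \<open>n - 1\<close>
  has exceptional points.\<close>

lemma W0_D:
  assumes f: "f \<in> W0 n" and "n > 0"
  obtains N where "negligible N"
    "\<And>j x. j < n \<Longrightarrow> x \<in> {0..1} - N \<Longrightarrow> (D j f has_vector_derivative D (Suc j) f x) (at x within {0..1})"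
proof -
  have "AE x in lebesgue. x \<in> {0..1} \<longrightarrow> D (n - 1) f differentiable at x within {0..1}"
    using f by (simp add: W0_def)
  then obtain N where N: "N \<in> null_sets lebesgue"
    "{x. \<not> (x \<in> {0..1} \<longrightarrow> D (n - 1) f differentiable at x within {0..1})} \<subseteq> N"
    by (auto simp: eventually_ae_filter)
  show ?thesis
  proof (rule that)
    show "negligible N" using N(1) by (simp add: negligible_iff_null_sets)
    fix j x assume jx: "j < n" "x \<in> {0..1} - N"
    have "D j f differentiable at x within {0..1}"
    proof (cases "Suc j < n")
      case True
      then show ?thesis using f jx by (simp add: W0_def)
    next
      case False
      then have "j = n - 1" using jx by simp
      then show ?thesis using N(2) jx(2) by auto
    qed
    then show "(D j f has_vector_derivative D (Suc j) f x) (at x within {0..1})"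
      by (simp add: vector_derivative_works)
  qed
qed

text \<open>Taylor's formula on \<open>{0..a}\<close> gives the value for \<open>trunc_pow\<close>.
  Subtracting the projection changes nothing: integrated by parts against \<open>D n f\<close>, a
  polynomial of degree below \<open>n\<close> leaves only boundary terms, which are zero.\<close>

lemma W0_remainder_integral:
  assumes f: "f \<in> W0 n" and n: "n = Suc l + k" and a: "0 < a" "a < 1"
  shows "((\<lambda>x. (trunc_pow a l x - poly (leg_proj a l n) x) * D n f x) has_integral D k f a) {0..1}"
proof -
  have "n > 0" by (simp add: n)
  obtain N where N: "negligible N" and
    deriv: "\<And>j x. j < n \<Longrightarrow> x \<in> {0..1} - N \<Longrightarrow> (D j f has_vector_derivative D (Suc j) f x) (at x within {0..1})"
    using W0_D[OF f \<open>n > 0\<close>] by blast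
  have ac: "abs_cont_on 0 1 (D j f)" and bd: "D j f 0 = 0" "D j f 1 = 0" if "j < n" for j
    using f that by (simp_all add: W0_def)
  have "((\<lambda>x. (a - x) ^ l / fact l * D n f x) has_integral D (n - 1 - l) f a) {0..a}"
  proof (rule Taylor_integral_abs_cont[where u = "\<lambda>j. D j f" and N = N])
    show "abs_cont_on 0 a (D j f)" if "j < n" for j
      by (rule abs_cont_on_subinterval[OF ac[OF that]]) (use a in auto)
    show "(D j f has_vector_derivative D (Suc j) f x) (at x within {0..a})" if "j < n" "x \<in> {0..a} - N" for j x
      by (rule has_vector_derivative_within_subset[OF deriv]) (use that a in auto)
  qed (use a N bd n in auto)
  then have 1: "((\<lambda>x. trunc_pow a l x * D n f x) has_integral D k f a) {0..1}"
    using a n by (intro trunc_pow_has_integral) auto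
  define \<Phi> where "\<Phi> x = (\<Sum>j<n. (-1) ^ j * poly ((pderiv ^^ j) (leg_proj a l n)) x * D (n - 1 - j) f x)" for x
  have "((\<lambda>x. poly (leg_proj a l n) x * D n f x) has_integral \<Phi> 1 - \<Phi> 0) {0..1}"
    unfolding \<Phi>_def
    by (rule higher_integration_by_parts[where u = "\<lambda>j. D j f", OF _ ac N deriv degree_leg_proj[OF \<open>n > 0\<close>]]) auto
  moreover have "\<Phi> 1 = 0" "\<Phi> 0 = 0" by (auto simp: \<Phi>_def bd intro!: sum.neutral)
  ultimately have "((\<lambda>x. poly (leg_proj a l n) x * D n f x) has_integral 0) {0..1}" by simp
  from has_integral_diff[OF 1 this] show ?thesis by (simp add: left_diff_distrib)
qed

text \<open>Cauchy-Schwarz is applied to the remainder instead of \<open>trunc_pow\<close>: it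
  represents the same functional with the smallest norm.\<close>

lemma D_upper_bound:
  assumes f: "f \<in> W0 n" and n: "n = Suc l + k" and a: "0 < a" "a < 1"
    and le1: "(LINT x:{0..1}|lebesgue. \<bar>D n f x\<bar>\<^sup>2) \<le> 1"
  shows "\<bar>D k f a\<bar> \<le> sqrt (extremal_sq a l n)"
proof -
  define E where "E = (LINT x:{0..1}|lebesgue. \<bar>D n f x\<bar>\<^sup>2)"
  have "set_integrable lebesgue {0..1} (\<lambda>x. \<bar>D n f x\<bar>\<^sup>2)"
    using f by (simp add: W0_def L2_def)
  then have "((\<lambda>x. \<bar>D n f x\<bar>\<^sup>2) has_integral E) {0..1}"
    unfolding E_def by (metis set_lebesgue_integral_eq_integral integrable_integral)
  then have 2: "((\<lambda>x. (D n f x)\<^sup>2) has_integral E) {0..1}" by simp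
  have 1: "((\<lambda>x. (trunc_pow a l x - poly (leg_proj a l n) x)\<^sup>2) has_integral extremal_sq a l n) {0..1}"
    using a n by (intro remainder_square_integral) auto
  have V: "extremal_sq a l n \<ge> 0" using 1 by (rule has_integral_nonneg) simp
  have "(D k f a)\<^sup>2 \<le> extremal_sq a l n * E"
    by (rule has_integral_Cauchy_Schwarz[OF 1 2 W0_remainder_integral[OF f n a]])
  also have "\<dots> \<le> extremal_sq a l n * 1" by (rule mult_left_mono) (use le1 V in \<open>auto simp: E_def\<close>)
  finally show ?thesis by (simp add: real_le_rsqrt)
qed

section \<open>The extremal function\<close>

text \<open>The value at \<open>a\<close> is 0 even for \<open>r = 0\<close>, complementing
  \<open>trunc_pow\<close>, whose first case includes \<open>a\<close>.\<close>

definition upper_pow :: "real \<Rightarrow> nat \<Rightarrow> real \<Rightarrow> real" where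
  "upper_pow a r x = (if x \<le> a then 0 else (x - a) ^ r / fact r)"

text \<open>A form that shows continuity at \<open>a\<close>. For \<open>r = 0\<close> it fails to
  the left of \<open>a\<close>, as \<open>0 ^ 0 = 1\<close>.\<close>

lemma upper_pow_max: "r > 0 \<Longrightarrow> upper_pow a r = (\<lambda>x. max 0 (x - a) ^ r * (1 / fact r))"
  by (rule ext) (auto simp: upper_pow_def max_def)

lemma abs_cont_on_upper_pow:
  assumes "r > 0"
  shows "abs_cont_on b c (upper_pow a r)"
proof -
  have "abs_cont_on b c (\<lambda>x. max 0 (x - a))"
    by (rule abs_cont_on_lipschitz[of _ _ _ 1]) auto
  then show ?thesis
    unfolding upper_pow_max[OF assms]
    by (intro abs_cont_on_mult abs_cont_on_power abs_cont_on_const)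
qed

lemma upper_pow_has_derivative:
  assumes "x \<noteq> a \<or> r > 0"
  shows "(upper_pow a (Suc r) has_real_derivative upper_pow a r x) (at x)"
proof (cases x a rule: linorder_cases)
  case less
  have "((\<lambda>x. 0) has_real_derivative 0) (at x)" by simp
  then show ?thesis
    by (rule has_field_derivative_transform_within_open[of _ _ _ "{..<a}", THEN DERIV_cong])
       (use less in \<open>auto simp: upper_pow_def\<close>)
next
  case greater
  have "((\<lambda>x. (x - a) ^ Suc r) has_real_derivative real (Suc r) * (x - a) ^ r) (at x)"
    by (rule derivative_eq_intros refl)+ simp
  then have "((\<lambda>x. (x - a) ^ Suc r / fact (Suc r)) has_real_derivative
      real (Suc r) * (x - a) ^ r / fact (Suc r)) (at x)"
    by (rule DERIV_cdivide)
  then show ?thesis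
    by (rule has_field_derivative_transform_within_open[of _ _ _ "{a<..}", THEN DERIV_cong])
       (use greater in \<open>auto simp: upper_pow_def divide_simps\<close>)
next
  case equal
  with assms have "r > 0" by simp
  show ?thesis
    \<comment> \<open>At the junction Caratheodory's criterion applies: the factor of
      \<open>z - x\<close> is a multiple of \<open>upper_pow a r\<close>, continuous because
      \<open>r > 0\<close>.\<close>
    unfolding CARAT_DERIV
  proof (intro exI conjI allI)
    show "upper_pow a (Suc r) z - upper_pow a (Suc r) x = upper_pow a r z / real (Suc r) * (z - x)" for z
      by (simp add: upper_pow_def equal mult_ac del: of_nat_Suc)
    show "isCont (\<lambda>z. upper_pow a r z / real (Suc r)) x"
      unfolding upper_pow_max[OF \<open>r > 0\<close>] by (intro continuous_intros) simp
    show "upper_pow a r x / real (Suc r) = upper_pow a r x" by (simp add: upper_pow_def equal)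
  qed
qed

text \<open>Derivatives within \<open>{0..1}\<close> are unique, so \<open>D\<close> follows any
  explicit chain of derivatives. The top order is left out, as \<open>u (n - 1)\<close> may fail to
  be differentiable somewhere.\<close>

lemma D_eq_chain:
  assumes deriv: "\<And>j x. Suc j < n \<Longrightarrow> x \<in> {0..1} \<Longrightarrow> (u j has_vector_derivative u (Suc j) x) (at x within {0..1})"
  shows "j < n \<Longrightarrow> x \<in> {0..1} \<Longrightarrow> D j (u 0) x = u j x"
proof (induction j arbitrary: x)
  case (Suc j)
  have "(D j (u 0) has_vector_derivative u (Suc j) x) (at x within {0..1})"
    by (rule has_vector_derivative_transform[OF Suc.prems(2) _ deriv]) (use Suc in auto)
  then show ?case
    using Suc.prems by (simp add: vector_derivative_within_closed_interval)
qed simp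

text \<open>Made for the extremal function, whose derivative of order \<open>n - 1\<close> may have
  a corner at \<open>a\<close>.\<close>

lemma W0_chainI:
  assumes n: "n > 0" and a: "0 < a" "a < 1"
    and ac: "\<And>j. j < n \<Longrightarrow> abs_cont_on 0 1 (u j)"
    and deriv: "\<And>j x. Suc j < n \<Longrightarrow> x \<in> {0..1} \<Longrightarrow> (u j has_vector_derivative u (Suc j) x) (at x within {0..1})"
    and deriv': "\<And>x. x \<in> {0..1} - {a} \<Longrightarrow> (u (n - 1) has_vector_derivative u n x) (at x within {0..1})"
    and zero: "\<And>j. j < n \<Longrightarrow> u j 0 = 0" "\<And>j. j < n \<Longrightarrow> u j 1 = 0"
    and meas: "u n \<in> borel_measurable borel"
    and sq: "((\<lambda>x. (u n x)\<^sup>2) has_integral E) {0..1}"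
  shows "u 0 \<in> W0 n" "(LINT x:{0..1}|lebesgue. \<bar>D n (u 0) x\<bar>\<^sup>2) = E"
proof -
  note D_eq = D_eq_chain[of n u, OF deriv]
  have D_has: "(D j (u 0) has_vector_derivative v) (at x within {0..1})"
    if "j < n" "x \<in> {0..1}" "(u j has_vector_derivative v) (at x within {0..1})" for j x v
    by (rule has_vector_derivative_transform[OF that(2) _ that(3)], rule D_eq) (use that in auto)
  have Dn: "D n (u 0) x = u n x" if "x \<in> {0..1} - {a}" for x
  proof -
    have "(D (n - 1) (u 0) has_vector_derivative u n x) (at x within {0..1})"
      by (rule D_has[OF _ _ deriv'[OF that]]) (use n that in auto)
    then have "D (Suc (n - 1)) (u 0) x = u n x"
      using that by (simp add: vector_derivative_within_closed_interval)
    then show ?thesis using n by simp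
  qed
  have int: "((\<lambda>x. \<bar>D n (u 0) x\<bar>\<^sup>2) has_integral E) {0..1}"
    by (rule has_integral_spike[OF _ _ sq, of "{a}"]) (use Dn in auto)
  then have abs_int: "set_integrable lebesgue {0..1} (\<lambda>x. \<bar>D n (u 0) x\<bar>\<^sup>2)"
    by (intro nonnegative_absolutely_integrable_1) (auto simp: has_integral_integrable)
  show "(LINT x:{0..1}|lebesgue. \<bar>D n (u 0) x\<bar>\<^sup>2) = E"
    using set_lebesgue_integral_eq_integral(2)[OF abs_int] integral_unique[OF int] by simp
  \<comment> \<open>The value of \<open>D n (u 0)\<close> at \<open>a\<close> is unknown, but
    changing a Borel function at one point keeps it measurable.\<close>
  define h where "h x = (if x = a then D n (u 0) a else indicat_real {0..1} x *\<^sub>R u n x)" for x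
  have "h \<in> borel_measurable borel" unfolding h_def using meas by measurable
  then have "h \<in> borel_measurable lebesgue" by (intro measurable_completion) simp
  moreover have "(\<lambda>x. indicat_real {0..1} x *\<^sub>R D n (u 0) x) = h"
    using Dn a by (auto simp: fun_eq_iff indicator_def h_def)
  ultimately have "D n (u 0) \<in> L2"
    using abs_int by (simp add: L2_def set_borel_measurable_def)
  moreover have "D j (u 0) differentiable at x within {0..1}" if "Suc j < n" "x \<in> {0..1}" for j x
    using D_has[OF _ _ deriv[OF that]] that
    by (auto intro: differentiableI_vector)
  moreover have "AE x in lebesgue. x \<in> {0..1} \<longrightarrow> D (n - 1) (u 0) differentiable at x within {0..1}"
  proof (rule AE_I')
    show "{a} \<in> null_sets lebesgue" by (simp add: negligible_iff_null_sets[symmetric])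
    have "D (n - 1) (u 0) differentiable at x within {0..1}" if "x \<in> {0..1} - {a}" for x
      using D_has[OF _ _ deriv'[OF that]] n that by (auto intro: differentiableI_vector)
    then show "{x \<in> space lebesgue. \<not> (x \<in> {0..1} \<longrightarrow> D (n - 1) (u 0) differentiable at x within {0..1})} \<subseteq> {a}"
      by auto
  qed
  moreover have "abs_cont_on 0 1 (D j (u 0))" if "j < n" for j
    by (rule abs_cont_on_cong[OF ac[OF that]], rule D_eq) (use that in auto)
  ultimately show "u 0 \<in> W0 n"
    using zero D_eq by (simp add: W0_def)
qed

text \<open>Equality in Cauchy-Schwarz asks for \<open>D n f\<close> proportional to the remainder
  \<open>g\<close>, so \<open>f\<close> is its normalised \<open>n\<close>-fold antiderivative from
  0. The conditions at 1 follow from the orthogonality of \<open>g\<close> to polynomials.\<close>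

lemma extremal_function_exists:
  assumes n: "n = Suc l + k" and a: "0 < a" "a < 1"
  obtains f where "f \<in> W0 n" "(LINT x:{0..1}|lebesgue. \<bar>D n f x\<bar>\<^sup>2) \<le> 1"
    "D k f a = sqrt (extremal_sq a l n)"
proof -
  define V where "V = extremal_sq a l n"
  define g where "g x = trunc_pow a l x - poly (leg_proj a l n) x" for x
  define R where "R = divpow a l - leg_proj a l n"
  define s where "s = 1 / sqrt V" \<comment> \<open>is \<open>0\<close> if \<open>V = 0\<close>, and then \<open>u 0 = 0\<close> is extremal\<close>
  \<comment> \<open>The \<open>(n - j)\<close>-fold antiderivative of \<open>s * g\<close>:
    \<open>g\<close> is \<open>R\<close> plus \<open>(-1) ^ Suc l * upper_pow a l\<close>, and each
    antiderivative raises the index of \<open>upper_pow\<close> by one.\<close>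
  define u where "u j x = s * (poly ((pint ^^ (n - j)) R) x + (-1) ^ Suc l * upper_pow a (l + n - j) x)" for j x
  have "n > 0" by (simp add: n)
  have g2: "((\<lambda>x. (g x)\<^sup>2) has_integral V) {0..1}"
    unfolding g_def V_def using a \<open>n > 0\<close> by (intro remainder_square_integral) auto
  have V: "V \<ge> 0" using g2 by (rule has_integral_nonneg) simp
  have un: "u n x = s * g x" for x
  proof -
    have "trunc_pow a l x = (a - x) ^ l / fact l + (-1) ^ Suc l * upper_pow a l x"
      by (cases "x \<le> a") (auto simp: trunc_pow_def upper_pow_def minus_power_mult_self
        simp flip: power_mult_distrib)
    then show ?thesis by (simp add: u_def g_def R_def poly_divpow)
  qed
  have deriv: "(u j has_vector_derivative u (Suc j) x) (at x within S)"
    if "j < n" "x \<noteq> a \<or> Suc j < n" for j x S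
  proof -
    have 1: "n - j = Suc (n - Suc j)" "l + n - j = Suc (l + n - Suc j)" using that by auto
    have 2: "(poly ((pint ^^ (n - j)) R) has_real_derivative poly ((pint ^^ (n - Suc j)) R) x) (at x)"
      using poly_DERIV[of "(pint ^^ (n - j)) R" x] by (simp add: 1(1) pderiv_pint)
    have 3: "(upper_pow a (l + n - j) has_real_derivative upper_pow a (l + n - Suc j) x) (at x)"
      unfolding 1(2) by (rule upper_pow_has_derivative) (use that in auto)
    have "(u j has_real_derivative u (Suc j) x) (at x)"
      unfolding u_def by (intro DERIV_cmult DERIV_add 2 3)
    then show ?thesis
      unfolding has_real_derivative_iff_has_vector_derivative[symmetric]
      by (rule DERIV_subset) simp
  qed
  have ac: "abs_cont_on b c (u j)" if "j < n" for j b c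
    unfolding u_def using that
    by (intro abs_cont_on_mult abs_cont_on_add abs_cont_on_const abs_cont_on_poly abs_cont_on_upper_pow) auto
  have zero: "u j 0 = 0" if "j < n" for j
    using that a by (simp add: u_def poly_pint_funpow_0 upper_pow_def)
  have one: "u j 1 = 0" if "j < n" for j
  proof -
    \<comment> \<open>Taylor's formula expresses \<open>u j 1\<close> through the kernel of degree
      \<open>i < n\<close>, to which \<open>g\<close> is orthogonal.\<close>
    define i where "i = n - 1 - j"
    have i: "i < n" "n - 1 - i = j" using that by (auto simp: i_def)
    have "((\<lambda>x. (1 - x) ^ i / fact i * u n x) has_integral u (n - 1 - i) 1) {0..1}"
      by (rule Taylor_integral_abs_cont[where u = u and N = "{a}"]) (use deriv ac zero i in auto)
    then have 1: "((\<lambda>x. (1 - x) ^ i / fact i * u n x) has_integral u j 1) {0..1}" by (simp only: i(2))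
    have "((\<lambda>x. g x * poly (divpow 1 i) x) has_integral 0) {0..1}"
      unfolding g_def using a i
      by (intro remainder_orthogonal le_less_trans[OF degree_divpow_le]) auto
    then have 2: "((\<lambda>x. (1 - x) ^ i / fact i * u n x) has_integral 0) {0..1}"
      using has_integral_mult_right[of "\<lambda>x. g x * poly (divpow 1 i) x" 0 "{0..1}" s]
      by (simp add: un poly_divpow ac_simps)
    show ?thesis by (rule has_integral_unique[OF 1 2])
  qed
  have sq: "((\<lambda>x. (u n x)\<^sup>2) has_integral s\<^sup>2 * V) {0..1}"
    using has_integral_mult_right[OF g2, of "s\<^sup>2"] by (simp add: un power_mult_distrib)
  have meas: "u n \<in> borel_measurable borel"
  proof -
    have "poly p \<in> borel_measurable borel" for p :: "real poly"
      by (intro borel_measurable_continuous_onI continuous_intros)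
    then show ?thesis
      unfolding un[abs_def] g_def trunc_pow_def by measurable
  qed
  have d1: "(u j has_vector_derivative u (Suc j) x) (at x within {0..1})" if "Suc j < n" for j x
    using deriv[of j x] that by auto
  have d2: "(u (n - 1) has_vector_derivative u n x) (at x within {0..1})" if "x \<in> {0..1} - {a}" for x
    using deriv[of "n - 1" x] that \<open>n > 0\<close> by auto
  note W = W0_chainI[of n a u "s\<^sup>2 * V", OF \<open>n > 0\<close> a ac d1 d2 zero one meas sq]
  show ?thesis
  proof (rule that)
    show "u 0 \<in> W0 n" by (rule W) (use \<open>n > 0\<close> in auto)
    have "(LINT x:{0..1}|lebesgue. \<bar>D n (u 0) x\<bar>\<^sup>2) = s\<^sup>2 * V" by (rule W) (use \<open>n > 0\<close> in auto)
    also have "\<dots> \<le> 1" using V by (simp add: s_def power_divide)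
    finally show "(LINT x:{0..1}|lebesgue. \<bar>D n (u 0) x\<bar>\<^sup>2) \<le> 1" .
    \<comment> \<open>The inner product of \<open>trunc_pow\<close> and \<open>u n\<close> is
      computed twice: Taylor's formula gives \<open>u k a\<close>, the remainder identity gives
      \<open>s * V\<close>.\<close>
    have "((\<lambda>x. (a - x) ^ l / fact l * u n x) has_integral u (n - 1 - l) a) {0..a}"
      by (rule Taylor_integral_abs_cont[where u = u and N = "{a}"]) (use deriv ac zero a n in auto)
    then have 1: "((\<lambda>x. trunc_pow a l x * u n x) has_integral u k a) {0..1}"
      using a n by (intro trunc_pow_has_integral) auto
    have 2: "((\<lambda>x. trunc_pow a l x * u n x) has_integral s * V) {0..1}"
      using has_integral_mult_right[OF remainder_trunc_pow_integral[of a l n], of s] a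
      by (simp add: un g_def V_def ac_simps)
    have "u k a = s * V" by (rule has_integral_unique[OF 1 2])
    moreover have "D k (u 0) a = u k a"
      by (rule D_eq_chain[of n u]) (use deriv a n in auto)
    moreover have "s * V = sqrt V" using V by (simp add: s_def real_div_sqrt)
    ultimately show "D k (u 0) a = sqrt (extremal_sq a l n)" by (simp add: V_def)
  qed
qed

text \<open>The extremal function attains the Cauchy-Schwarz bound, so the supremum is a maximum. As
  the integral of a square, \<open>extremal_sq\<close> is nonnegative, hence squaring undoes the
  root.\<close>

theorem A_square_eq:
  assumes "n = Suc l + k" "0 < a" "a < 1"
  shows "(A n k a)\<^sup>2 = ereal (extremal_sq a l n)"
proof -
  have "A n k a = ereal (sqrt (extremal_sq a l n))"
    unfolding A_def
  proof (rule SUP_eqI)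
    fix f assume "f \<in> {f \<in> W0 n. (LINT x:{0..1}|lebesgue. \<bar>D n f x\<bar>\<^sup>2) \<le> 1}"
    then show "ereal \<bar>D k f a\<bar> \<le> ereal (sqrt (extremal_sq a l n))"
      using D_upper_bound[OF _ assms] by simp
  next
    fix y assume y: "\<And>f. f \<in> {f \<in> W0 n. (LINT x:{0..1}|lebesgue. \<bar>D n f x\<bar>\<^sup>2) \<le> 1} \<Longrightarrow> ereal \<bar>D k f a\<bar> \<le> y"
    obtain f where f: "f \<in> W0 n" "(LINT x:{0..1}|lebesgue. \<bar>D n f x\<bar>\<^sup>2) \<le> 1"
      "D k f a = sqrt (extremal_sq a l n)"
      using extremal_function_exists[OF assms] .
    have "ereal (sqrt (extremal_sq a l n)) \<le> ereal \<bar>D k f a\<bar>" using f(3) by simp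
    also have "\<dots> \<le> y" using y f(1,2) by blast
    finally show "ereal (sqrt (extremal_sq a l n)) \<le> y" .
  qed
  moreover have "extremal_sq a l n \<ge> 0"
    using remainder_square_integral[of a n l] assms by (auto intro: has_integral_nonneg)
  ultimately show ?thesis by (simp add: power2_eq_square)
qed

section \<open>The third derivative\<close>

text \<open>The closed sum of the first \<open>l + 1\<close> squares cancels the power of
  \<open>a\<close>. The three other coefficients are, up to factors, the derivatives of order 0, 1
  and 2 of successive powers of \<open>sqp\<close>.\<close>

lemma extremal_sq_3:
  assumes t: "t = a\<^sup>2 - a"
  shows "extremal_sq a l (l + 4) =
    - (t ^ (2 * l + 1)) / ((2 * real l + 1) * (fact l)\<^sup>2)
    - (2 * real l + 3) * (t ^ Suc l / fact (Suc l))\<^sup>2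
    - (2 * real l + 5) * (t ^ Suc l * (2 * a - 1) / fact (Suc l))\<^sup>2
    - (2 * real l + 7) * ((2 * (2 * real l + 5) * t ^ (l + 2) + (real l + 2) * t ^ Suc l) / fact (l + 2))\<^sup>2"
proof -
  have S: "(\<Sum>j<Suc l. (2 * real j + 1) * (pint_coeff a l j)\<^sup>2) =
     a ^ (2 * l + 1) / ((2 * real l + 1) * (fact l)\<^sup>2) + t ^ (2 * l + 1) / ((2 * real l + 1) * (fact l)\<^sup>2)"
    using arg_cong[OF sum_pint_leg_squares[of l], of "\<lambda>p. poly p a"]
    by (simp add: poly_sum pint_coeff_def poly_monom poly_sqp t del: sum.lessThan_Suc funpow.simps power_Suc)
  have c0: "pint_coeff a l (Suc l) = t ^ Suc l / fact (Suc l)"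
    by (simp add: pint_coeff_def pint_funpow_leg poly_sqp t del: funpow.simps power_Suc)
  have c1: "pint_coeff a l (Suc (Suc l)) = t ^ Suc l * (2 * a - 1) / fact (Suc l)"
  proof -
    have "(pint ^^ Suc l) (leg (Suc (Suc l))) = smult (1 / fact (Suc (Suc l))) (pderiv (sqp ^ Suc (Suc l)))"
      using pint_funpow_leg[of "Suc l" "Suc (Suc l)"] by (simp add: Suc_diff_le)
    then have "pint_coeff a l (Suc (Suc l)) = poly (pderiv (sqp ^ Suc (Suc l))) a / fact (Suc (Suc l))"
      unfolding pint_coeff_def by (simp only: poly_smult times_divide_eq_left mult_1)
    also have "pderiv (sqp ^ Suc (Suc l)) = smult (real (Suc (Suc l))) (sqp ^ Suc l * [:-1, 2:])"
      unfolding pderiv_power_Suc pderiv_sqp by (simp only: mult_smult_left)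
    also have "poly \<dots> a / fact (Suc (Suc l))
        = real (Suc (Suc l)) * (t ^ Suc l * (2 * a - 1)) / (real (Suc (Suc l)) * fact (Suc l))"
    proof -
      have "poly [:-1, 2:] a = 2 * a - 1" by simp
      then show ?thesis by (simp only: poly_smult poly_mult poly_power poly_sqp t fact_Suc[of "Suc l"] of_nat_mult)
    qed
    finally show ?thesis by (simp del: power_Suc of_nat_Suc fact_Suc)
  qed
  have c2: "pint_coeff a l (Suc (Suc (Suc l))) =
      (2 * (2 * real l + 5) * t ^ (l + 2) + (real l + 2) * t ^ Suc l) / fact (l + 2)"
  proof -
    have "(pint ^^ Suc l) (leg (Suc (Suc (Suc l))))
        = smult (1 / fact (Suc (Suc (Suc l)))) (pderiv (pderiv (sqp ^ Suc (Suc (Suc l)))))"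
      using pint_funpow_leg[of "Suc l" "Suc (Suc (Suc l))"] by (simp add: Suc_diff_le)
    then have "pint_coeff a l (Suc (Suc (Suc l)))
        = poly (pderiv (pderiv (sqp ^ Suc (Suc (Suc l))))) a / fact (Suc (Suc (Suc l)))"
      unfolding pint_coeff_def by (simp only: poly_smult times_divide_eq_left mult_1)
    also have "\<dots> = real (Suc (Suc (Suc l))) * (2 * (2 * real (Suc l) + 3) * t ^ Suc (Suc l) + real (Suc (Suc l)) * t ^ Suc l)
        / (real (Suc (Suc (Suc l))) * fact (Suc (Suc l)))"
      unfolding pderiv2_sqp_power fact_Suc[of "Suc (Suc l)"]
      by (simp add: poly_sqp t del: fact_Suc of_nat_Suc power_Suc)
    also have "\<dots> = (2 * (2 * real (Suc l) + 3) * t ^ Suc (Suc l) + real (Suc (Suc l)) * t ^ Suc l) / fact (Suc (Suc l))"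
      by (simp del: power_Suc of_nat_Suc fact_Suc)
    finally show ?thesis by (simp add: algebra_simps del: power_Suc fact_Suc)
  qed
  have "(\<Sum>j<l + 4. F j) = (\<Sum>j<Suc l. F j) + F (Suc l) + F (Suc (Suc l)) + F (Suc (Suc (Suc l)))" for F :: "nat \<Rightarrow> real"
    by (simp add: eval_nat_numeral)
  moreover have "2 * real (Suc l) + 1 = 2 * real l + 3" "2 * real (Suc (Suc l)) + 1 = 2 * real l + 5"
    "2 * real (Suc (Suc (Suc l))) + 1 = 2 * real l + 7" by simp_all
  ultimately show ?thesis
    unfolding extremal_sq_def by (simp only: S c0 c1 c2)
qed

theorem mainTheorem3:
  fixes n :: nat and a t :: real
  assumes "n \<ge> 4" and "a \<in> {0<..<1}" and "t = a\<^sup>2 - a"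
  shows "(A n 3 a)\<^sup>2 = ereal
    (- (t ^ (2 * n - 7)) / ((fact (n - 2))\<^sup>2 * (2 * real n - 7)) *
      (4 * (2 * real n - 1) * (2 * real n - 3)\<^sup>2 * (2 * real n - 7) * t ^ 3
       + 12 * (real n - 1) * (real n - 2) * (2 * real n - 3) * (2 * real n - 7) * t\<^sup>2
       + 3 * (real n - 2)\<^sup>2 * (2 * real n - 3) * (2 * real n - 7) * t
       + (real n - 2)\<^sup>2 * (real n - 3)\<^sup>2))"
proof -
  obtain l where l: "n = l + 4" using assms(1) by (metis le_add_diff_inverse2)
  define x where "x = real l"
  define F where "F = (fact l :: real)"
  \<comment> \<open>A factor common to all terms, as the square of \<open>t ^ Suc l\<close> is
    \<open>t * P\<close>.\<close>
  define P where "P = t ^ (2 * l + 1)"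
  have nz: "x \<ge> 0" "x + 1 \<noteq> 0" "x + 2 \<noteq> 0" "2 * x + 1 \<noteq> 0" "F \<noteq> 0"
    by (simp_all add: x_def F_def add_nonneg_eq_0_iff)
  have fact1: "fact (Suc l) = (x + 1) * F" by (simp add: x_def F_def)
  have fact2: "fact (l + 2) = (x + 2) * (x + 1) * F"
    by (simp add: x_def F_def numeral_2_eq_2 algebra_simps)
  \<comment> \<open>This removes \<open>a\<close> from the square of the coefficient with index
    \<open>l + 2\<close>; everything else depends on \<open>t\<close> alone.\<close>
  have sq: "(2 * a - 1)\<^sup>2 = 4 * t + 1"
    by (simp add: assms(3) power2_eq_square algebra_simps)
  have p1: "(t ^ Suc l)\<^sup>2 = t * P" by (simp add: P_def power2_eq_square mult_2 power_add)
  have p2: "2 * (2 * x + 5) * t ^ (l + 2) + (x + 2) * t ^ Suc l = t ^ Suc l * (2 * (2 * x + 5) * t + (x + 2))"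
    by (simp add: numeral_2_eq_2 algebra_simps)
  have "extremal_sq a l n = - P / ((2 * x + 1) * F\<^sup>2) - (2 * x + 3) * (t * P / ((x + 1) * F)\<^sup>2)
      - (2 * x + 5) * (t * P * (4 * t + 1) / ((x + 1) * F)\<^sup>2)
      - (2 * x + 7) * (t * P * (2 * (2 * x + 5) * t + (x + 2))\<^sup>2 / ((x + 2) * (x + 1) * F)\<^sup>2)"
    unfolding l extremal_sq_3[OF assms(3)] fact1 fact2 x_def[symmetric] F_def[symmetric] P_def[symmetric]
      p2 power_divide power_mult_distrib[of "t ^ Suc l"] p1 sq ..
  also have "\<dots> = - P / (((x + 2) * (x + 1) * F)\<^sup>2 * (2 * x + 1)) *
      (4 * (2 * x + 7) * (2 * x + 5)\<^sup>2 * (2 * x + 1) * t ^ 3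
       + 12 * (x + 3) * (x + 2) * (2 * x + 5) * (2 * x + 1) * t\<^sup>2
       + 3 * (x + 2)\<^sup>2 * (2 * x + 5) * (2 * x + 1) * t
       + (x + 2)\<^sup>2 * (x + 1)\<^sup>2)"
    \<comment> \<open>Clearing denominators leaves a polynomial identity in \<open>x\<close>,
      \<open>t\<close>, \<open>P\<close> and \<open>F\<close>.\<close>
    using nz by (simp add: divide_simps) (simp add: power2_eq_square power3_eq_cube algebra_simps)
  finally have V: "extremal_sq a l n = \<dots>" .
  have "n = Suc l + 3" using l by simp
  then have "(A n 3 a)\<^sup>2 = ereal (extremal_sq a l n)"
    using assms(2) by (intro A_square_eq) auto
  moreover have "2 * n - 7 = 2 * l + 1" "n - 2 = l + 2" "real n - 1 = x + 3" "real n - 2 = x + 2"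
    "real n - 3 = x + 1" "2 * real n - 7 = 2 * x + 1" "2 * real n - 3 = 2 * x + 5" "2 * real n - 1 = 2 * x + 7"
    by (simp_all add: l x_def)
  ultimately show ?thesis
    unfolding V P_def by (simp only: fact2)
qed

end
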